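(* Let $n\ge 2$, $k\ge 1$, and let $u$ be a unitary in $\mathcal F_n^k$. Then the following conditions are equivalent: (1) $\lambda_u$ is invertible with localized inverse (i.e. $\lambda_u\in\mathrm{Aut}(\mathcal O_n)$ and $\lambda_u^{-1}=\lambda_v$ for some unitary $v\in\bigcup_h\mathcal F_n^h$); (2) the sequence of unitaries $\big(\mathrm{Ad}(\varphi^m(u)\varphi^{m-1}(u)\cdots\varphi(u)u)(u^* )\big)_{m\ge 1}$ eventually stabilizes (i.e. is eventually constant); (3) the ring $A_u$ is nilpotent; (4) $\Xi_u\subseteq B_u$; (5) $\Xi_u=\mathbb C1$.
   Context: For $n\ge2$, $\mathcal O_n$ is the Cuntz algebra, generated by isometries $S_1,\dots,S_n$ with $\sum_i S_iS_i^*=1$. $W_n^k$ is the set of $k$-tuples from $\{1,\dots,n\}$ ($W_n^0$ contains only the empty word), and $S_\alpha=S_{\alpha_1}\cdots S_{\alpha_k}$ for $\alpha\in W_n^k$ ($S_\emptyset=1$). $\mathcal F_n^k=\mathrm{span}\{S_\alpha S_\beta^*:\alpha,\beta\in W_n^k\}\cong M_{n^k}(\mathbb C)$, with $\mathcal F_n^0=\mathbb C1$ and $\mathcal F_n^k\subset\mathcal F_n^{k+1}$. $\varphi(a)=\sum_{i=1}^nS_iaS_i^*$. For a unitary $u\in\mathcal O_n$, $\lambda_u$ is the unital endomorphism of $\mathcal O_n$ with $\lambda_u(S_i)=u^*S_i$; it is invertible if it is an automorphism. An endomorphism is localized if it equals $\lambda_v$ for some unitary $v\in\bigcup_h\mathcal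 F_n^h$. $\mathrm{Ad}(v)(x)=vxv^*$. For a unitary $u\in\mathcal F_n^k$: - $B_u=\{u,\varphi(u),\dots,\varphi^{k-2}(u)\}'\cap\mathcal F_n^{k-1}$ if $k\ge2$ (prime denotes commutant), and $B_u=\mathbb C1$ if $k=1$. - $a_{ij}^u:\mathcal F_n^{k-1}\to\mathcal F_n^{k-1}$, $a_{ij}^u(x)=S_i^*uxu^*S_j$, for $i,j\in\{1,\dots,n\}$. Since $a_{ij}^u(B_u)\subseteq B_u$, there are induced linear maps $\tilde a_{ij}^u$ on the quotient vector space $V_u=\mathcal F_n^{k-1}/B_u$. - $A_u$ is the (not necessarily unital) subring of the ring of linear maps $V_u\to V_u$ generated by all $\tilde a_{ij}^u$. It is nilpotent if $A_u^l=0$ for some $l\geq 1$, i.e. all products of $l$ elements vanish. - Let $H=\mathrm{span}\{S_1,\dots,S_n\}$. Define inductively subspaces $\Xi_0=\mathcal F_n^{k-1}$ and $\Xi_r=\lambda_u(H)^*\,\Xi_{r-1}\,\lambda_u(H)$ for $r\ge1$, meaning the linear span of all $S_i^*uxu^*S_j$ with $x\in\Xi_{r-1}$, $i,j\in\{1,\dots,n\}$. This is a nonincreasing sequence of subspaces of $\mathcal F_n^{k-1}$, and $\Xi_u:=\bigcap_r\Xi_r$. *)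

theory Defs
  imports Complex_Main "HOL-Library.FuncSet" "HOL-Library.Set_Algebras"
begin

section \<open>Unital C*-algebras\<close>

class cstar_algebra = real_normed_algebra_1 + banach +
  fixes scaleC :: "complex \<Rightarrow> 'a \<Rightarrow> 'a"  (infixr \<open>*\<^sub>C\<close> 75)
    and adj :: "'a \<Rightarrow> 'a"  (\<open>(_\<^sup>\<dagger>)\<close> [1000] 999)
  assumes scaleC_add_right: "c *\<^sub>C (x + y) = c *\<^sub>C x + c *\<^sub>C y"
    and scaleC_add_left: "(c + d) *\<^sub>C x = c *\<^sub>C x + d *\<^sub>C x"
    and scaleC_scaleC: "c *\<^sub>C (d *\<^sub>C x) = (c * d) *\<^sub>C x"
    and scaleC_one: "1 *\<^sub>C x = x"
    and scaleR_scaleC: "r *\<^sub>R x = complex_of_real r *\<^sub>C x"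
    and scaleC_mult_left: "(c *\<^sub>C x) * y = c *\<^sub>C (x * y)"
    and scaleC_mult_right: "x * (c *\<^sub>C y) = c *\<^sub>C (x * y)"
    and norm_scaleC: "norm (c *\<^sub>C x) = cmod c * norm x"
    and adj_add: "(x + y)\<^sup>\<dagger> = x\<^sup>\<dagger> + y\<^sup>\<dagger>"
    and adj_scaleC: "(c *\<^sub>C x)\<^sup>\<dagger> = cnj c *\<^sub>C x\<^sup>\<dagger>"
    and adj_mult: "(x * y)\<^sup>\<dagger> = y\<^sup>\<dagger> * x\<^sup>\<dagger>"
    and adj_adj: "(x\<^sup>\<dagger>)\<^sup>\<dagger> = x"
    and norm_adj_mult: "norm (x\<^sup>\<dagger> * x) = (norm x)\<^sup>2"

global_interpretation complex_vector:
  vector_space "scaleC :: complex \<Rightarrow> 'a \<Rightarrow> 'a::cstar_algebra"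
  defines cspan = complex_vector.span
    and csubspace = complex_vector.subspace
  by standard (simp_all add: scaleC_add_right scaleC_add_left scaleC_scaleC scaleC_one)

definition unitary :: "'a::cstar_algebra \<Rightarrow> bool" where
  "unitary u \<longleftrightarrow> u\<^sup>\<dagger> * u = 1 \<and> u * u\<^sup>\<dagger> = 1"

definition Ad :: "'a::cstar_algebra \<Rightarrow> 'a \<Rightarrow> 'a" where
  "Ad v x = v * x * v\<^sup>\<dagger>"

definition commutant :: "'a::cstar_algebra set \<Rightarrow> 'a set" where
  "commutant X = {x. \<forall>y\<in>X. x * y = y * x}"

definition cstar_subalgebra :: "'a::cstar_algebra set \<Rightarrow> bool" where
  "cstar_subalgebra X \<longleftrightarrow> csubspace X \<and> closed X \<and>
     (\<forall>x\<in>X. \<forall>y\<in>X. x * y \<in> X) \<and> (\<forall>x\<in>X. x\<^sup>\<dagger> \<in> X)"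

definition unital_endo :: "('a::cstar_algebra \<Rightarrow> 'a) \<Rightarrow> bool" where
  "unital_endo f \<longleftrightarrow>
     (\<forall>x y. f (x + y) = f x + f y) \<and> (\<forall>c x. f (c *\<^sub>C x) = c *\<^sub>C f x) \<and>
     (\<forall>x y. f (x * y) = f x * f y) \<and> (\<forall>x. f (x\<^sup>\<dagger>) = (f x)\<^sup>\<dagger>) \<and> f 1 = 1"

section \<open>The Cuntz algebra\<close>

definition cuntz_relations :: "nat \<Rightarrow> (nat \<Rightarrow> 'a::cstar_algebra) \<Rightarrow> bool" where
  "cuntz_relations n S \<longleftrightarrow>
     (\<forall>i\<in>{1..n}. (S i)\<^sup>\<dagger> * S i = 1) \<and> (\<Sum>i=1..n. S i * (S i)\<^sup>\<dagger>) = 1"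

text \<open>The type \<open>'a\<close>, with generators \<open>S 1, \<dots>, S n\<close>, is the Cuntz algebra: the universal unital
  C*-algebra generated by isometries with the Cuntz relation.  A formula cannot quantify over
  types, so universality is required only for tuples of isometries inside the algebra itself;
  this is the instance that makes the endomorphisms \<open>lam\<close> below well defined.  Since it is implied
  by the universal property with respect to all C*-algebras, nothing is lost.\<close>

locale cuntz_algebra =
  fixes n :: nat and S :: "nat \<Rightarrow> 'a::cstar_algebra"
  assumes n_ge_2: "n \<ge> 2"
    and relations: "cuntz_relations n S"
    and generated: "cstar_subalgebra X \<Longrightarrow> S ` {1..n} \<subseteq> X \<Longrightarrow> X = UNIV"
    and universal: "cuntz_relations n T \<Longrightarrow>
      \<exists>!f. unital_endo f \<and> (\<forall>i\<in>{1..n}. f (S i) = T i)"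

definition lam :: "nat \<Rightarrow> (nat \<Rightarrow> 'a::cstar_algebra) \<Rightarrow> 'a \<Rightarrow> 'a \<Rightarrow> 'a" where
  "lam n S u = (THE f. unital_endo f \<and> (\<forall>i\<in>{1..n}. f (S i) = u\<^sup>\<dagger> * S i))"

definition words :: "nat \<Rightarrow> nat \<Rightarrow> nat list set" where
  "words n k = {\<alpha>. set \<alpha> \<subseteq> {1..n} \<and> length \<alpha> = k}"

definition S_word :: "(nat \<Rightarrow> 'a::cstar_algebra) \<Rightarrow> nat list \<Rightarrow> 'a" where
  "S_word S \<alpha> = prod_list (map S \<alpha>)"

definition core :: "nat \<Rightarrow> (nat \<Rightarrow> 'a::cstar_algebra) \<Rightarrow> nat \<Rightarrow> 'a set" where
  "core n S k = cspan {S_word S \<alpha> * (S_word S \<beta>)\<^sup>\<dagger> | \<alpha> \<beta>. \<alpha> \<in> words n k \<and> \<beta> \<in> words n k}"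

definition phi :: "nat \<Rightarrow> (nat \<Rightarrow> 'a::cstar_algebra) \<Rightarrow> 'a \<Rightarrow> 'a" where
  "phi n S a = (\<Sum>i=1..n. S i * a * (S i)\<^sup>\<dagger>)"

definition localized :: "nat \<Rightarrow> (nat \<Rightarrow> 'a::cstar_algebra) \<Rightarrow> ('a \<Rightarrow> 'a) \<Rightarrow> bool" where
  "localized n S f \<longleftrightarrow> (\<exists>v. unitary v \<and> v \<in> (\<Union>h. core n S h) \<and> f = lam n S v)"

text \<open>\<open>u_prod n S u m\<close> is the product \<open>\<phi>\<^sup>m(u) \<cdots> \<phi>(u) u\<close>.\<close>

definition u_prod :: "nat \<Rightarrow> (nat \<Rightarrow> 'a::cstar_algebra) \<Rightarrow> 'a \<Rightarrow> nat \<Rightarrow> 'a" where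
  "u_prod n S u m = prod_list (map (\<lambda>j. (phi n S ^^ j) u) (rev [0..<Suc m]))"

section \<open>Objects associated with a unitary in the \<open>k\<close>-th matrix algebra\<close>

definition B_alg :: "nat \<Rightarrow> (nat \<Rightarrow> 'a::cstar_algebra) \<Rightarrow> nat \<Rightarrow> 'a \<Rightarrow> 'a set" where
  "B_alg n S k u =
     (if k \<ge> 2 then commutant {(phi n S ^^ j) u | j. j \<le> k - 2} \<inter> core n S (k - 1)
      else cspan {1})"

definition a_map ::
    "(nat \<Rightarrow> 'a::cstar_algebra) \<Rightarrow> 'a \<Rightarrow> nat \<Rightarrow> nat \<Rightarrow> 'a \<Rightarrow> 'a" where
  "a_map S u i j x = (S i)\<^sup>\<dagger> * u * x * u\<^sup>\<dagger> * S j"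

text \<open>Elements of the quotient space are cosets \<open>x +o B\<close>.  Sums of cosets are the elementwise
  sums of sets from Set_Algebras, and the zero vector is the coset \<open>B\<close> (not the set \<open>0 = {0}\<close>).
  Linear maps of the quotient are represented as functions that are \<open>undefined\<close> outside it, so
  that equality of functions is equality of maps.\<close>

definition V_quot :: "nat \<Rightarrow> (nat \<Rightarrow> 'a::cstar_algebra) \<Rightarrow> nat \<Rightarrow> 'a \<Rightarrow> 'a set set" where
  "V_quot n S k u = (\<lambda>x. x +o B_alg n S k u) ` core n S (k - 1)"

text \<open>As \<open>a_map S u i j\<close> is linear and preserves \<open>B\<close>, it sends \<open>x +o B\<close> into
  \<open>a_map S u i j x +o B\<close>; adding \<open>B\<close> to the image fills up the coset.\<close>

definition a_quot ::
    "nat \<Rightarrow> (nat \<Rightarrow> 'a::cstar_algebra) \<Rightarrow> nat \<Rightarrow> 'a \<Rightarrow> nat \<Rightarrow> nat \<Rightarrow> 'a set \<Rightarrow> 'a set" where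
  "a_quot n S k u i j = (\<lambda>C\<in>V_quot n S k u. a_map S u i j ` C + B_alg n S k u)"

definition zero_map ::
    "nat \<Rightarrow> (nat \<Rightarrow> 'a::cstar_algebra) \<Rightarrow> nat \<Rightarrow> 'a \<Rightarrow> 'a set \<Rightarrow> 'a set" where
  "zero_map n S k u = (\<lambda>C\<in>V_quot n S k u. B_alg n S k u)"

inductive_set A_ring ::
    "nat \<Rightarrow> (nat \<Rightarrow> 'a::cstar_algebra) \<Rightarrow> nat \<Rightarrow> 'a \<Rightarrow> ('a set \<Rightarrow> 'a set) set"
  for n S k u where
  gen: "i \<in> {1..n} \<Longrightarrow> j \<in> {1..n} \<Longrightarrow> a_quot n S k u i j \<in> A_ring n S k u"
| zero: "zero_map n S k u \<in> A_ring n S k u"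
| add: "f \<in> A_ring n S k u \<Longrightarrow> g \<in> A_ring n S k u \<Longrightarrow>
    (\<lambda>C\<in>V_quot n S k u. f C + g C) \<in> A_ring n S k u"
| minus: "f \<in> A_ring n S k u \<Longrightarrow> (\<lambda>C\<in>V_quot n S k u. uminus ` f C) \<in> A_ring n S k u"
| mult: "f \<in> A_ring n S k u \<Longrightarrow> g \<in> A_ring n S k u \<Longrightarrow>
    compose (V_quot n S k u) f g \<in> A_ring n S k u"

definition A_nilpotent :: "nat \<Rightarrow> (nat \<Rightarrow> 'a::cstar_algebra) \<Rightarrow> nat \<Rightarrow> 'a \<Rightarrow> bool" where
  "A_nilpotent n S k u \<longleftrightarrow>
     (\<exists>l\<ge>1. \<forall>fs. set fs \<subseteq> A_ring n S k u \<and> length fs = l \<longrightarrow>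
        foldr (compose (V_quot n S k u)) fs (\<lambda>C\<in>V_quot n S k u. C) = zero_map n S k u)"

primrec Xi :: "nat \<Rightarrow> (nat \<Rightarrow> 'a::cstar_algebra) \<Rightarrow> nat \<Rightarrow> 'a \<Rightarrow> nat \<Rightarrow> 'a set" where
  "Xi n S k u 0 = core n S (k - 1)"
| "Xi n S k u (Suc r) =
     cspan {a_map S u i j x | i j x. i \<in> {1..n} \<and> j \<in> {1..n} \<and> x \<in> Xi n S k u r}"

definition Xi_lim :: "nat \<Rightarrow> (nat \<Rightarrow> 'a::cstar_algebra) \<Rightarrow> nat \<Rightarrow> 'a \<Rightarrow> 'a set" where
  "Xi_lim n S k u = (\<Inter>r. Xi n S k u r)"

end

theory Submission imports Defs begin

text \<open>Everything is governed by the unitaries \<open>U r = \<phi>\<^sup>r\<^sup>-\<^sup>1(u) \<cdots> \<phi>(u) u\<close> (\<open>U u r\<close> below).  On the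
  \<open>r\<close>-th matrix algebra of the core, \<open>\<lambda>\<^sub>u\<close> is conjugation by the adjoint of \<open>U r\<close> (\<open>lam_core\<close>).
  Conversely an \<open>r\<close>-fold product of the maps \<open>a_map\<close> sends \<open>x\<close> to
  \<open>S\<^sub>\<alpha>\<^sup>\<dagger> U r x (U r)\<^sup>\<dagger> S\<^sub>\<beta>\<close> for words \<open>\<alpha>\<close>, \<open>\<beta>\<close> of length \<open>r\<close> (\<open>a_map_compression\<close>), so
  the \<open>r\<close>-th space \<open>\<Xi>\<^sub>r\<close> is spanned by the entries of the elements \<open>U r x (U r)\<^sup>\<dagger>\<close>, with \<open>x\<close> in the
  matrix algebra \<open>F\<close> of level \<open>k - 1\<close>, when these are read as matrices of size \<open>n\<^sup>r\<close>.  Such entries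
  are scalar exactly when the element lies in the matrix algebra of level \<open>r\<close>.

  An inverse \<open>\<lambda>\<^sub>v\<close> means \<open>\<lambda>\<^sub>u(v) = u\<^sup>\<dagger>\<close> (\<open>lam_inverse_iff\<close>).  If \<open>v\<close> is in a matrix algebra, this
  equation reads \<open>v = U r u\<^sup>\<dagger> (U r)\<^sup>\<dagger>\<close> for all large \<open>r\<close>; hence the inverse is localized if and only if
  the sequence \<open>U r u\<^sup>\<dagger> (U r)\<^sup>\<dagger>\<close> stabilizes, its final value being \<open>v\<close> (\<open>stabilizes_iff\<close>).  A one-sided inverse
  suffices, because \<open>\<lambda>\<^sub>u\<close> is injective on each matrix algebra.

  If \<open>\<lambda>\<^sub>v\<close> is such an inverse, then \<open>y = \<lambda>\<^sub>v(x)\<close> lies in a matrix algebra of some level \<open>r\<close> that does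
  not depend on \<open>x\<close> in \<open>F\<close>, and \<open>x = \<lambda>\<^sub>u(y)\<close> gives \<open>U r x (U r)\<^sup>\<dagger> = y\<close>: all entries at level \<open>r\<close> are
  scalar and \<open>\<Xi>\<^sub>r = \<complex>1\<close>.  Conversely, if \<open>\<Xi>\<^sub>r = \<complex>1\<close>, then \<open>U r x (U r)\<^sup>\<dagger>\<close> commutes with \<open>\<phi>\<^sup>m(u)\<close> for
  \<open>m \<ge> r\<close>, so that \<open>U m x (U m)\<^sup>\<dagger>\<close> does not change any more for \<open>m \<ge> r\<close>.  The entries of
  \<open>u\<^sup>\<dagger>\<close> with respect to the generators are in \<open>F\<close>, and the sequence stabilizes entry by entry.

  An element of \<open>B\<close> commutes with every \<open>\<phi>\<^sup>j(u)\<close>, so conjugation by \<open>U r\<close> fixes it and its entries at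
  level \<open>k - 1\<close> are scalar: thus \<open>\<Xi>\<^sub>l \<subseteq> B\<close> forces \<open>\<Xi>\<^sub>m = \<complex>1\<close> for \<open>m = l + k - 1\<close>.  Each element
  of the ring maps the image of \<open>\<Xi>\<^sub>r\<close> in the quotient into that of \<open>\<Xi>\<^sub>r\<^sub>+\<^sub>1\<close>, while the products of
  \<open>l\<close> generators have ranges spanning the image of \<open>\<Xi>\<^sub>l\<close>; hence nilpotency says \<open>\<Xi>\<^sub>l \<subseteq> B\<close> for some \<open>l\<close>.
  As the \<open>\<Xi>\<^sub>r\<close> decrease in a finite-dimensional space, they may be replaced by their intersection.

  All of this rests on the ranges of the generators being orthogonal, the one step with analytic
  content (\<open>orthogonal_ranges\<close>).\<close>

section \<open>Preliminaries on C*-algebras\<close>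

lemma adj_one [simp]: "(1::'a::cstar_algebra)\<^sup>\<dagger> = 1"
  by (metis adj_adj adj_mult mult.right_neutral mult.left_neutral)

lemma adj_zero [simp]: "(0::'a::cstar_algebra)\<^sup>\<dagger> = 0"
  using adj_scaleC[of 0 "0::'a"] by simp

lemma adj_minus: "(- x)\<^sup>\<dagger> = - (x::'a::cstar_algebra)\<^sup>\<dagger>"
  by (metis add_eq_0_iff adj_add adj_zero)

lemma adj_diff: "(x - y)\<^sup>\<dagger> = (x::'a::cstar_algebra)\<^sup>\<dagger> - y\<^sup>\<dagger>"
  by (metis add_uminus_conv_diff adj_add adj_minus)

lemma adj_scaleR: "(r *\<^sub>R x)\<^sup>\<dagger> = r *\<^sub>R (x::'a::cstar_algebra)\<^sup>\<dagger>"
  by (simp add: scaleR_scaleC adj_scaleC)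

lemma adj_sum: "(\<Sum>i\<in>I. f i)\<^sup>\<dagger> = (\<Sum>i\<in>I. (f i :: 'a::cstar_algebra)\<^sup>\<dagger>)"
  by (induction I rule: infinite_finite_induct) (simp_all add: adj_add)

lemmas star_simps = adj_add adj_diff adj_minus adj_mult adj_adj adj_sum

lemma norm_selfadjoint_square:
  "x\<^sup>\<dagger> = x \<Longrightarrow> norm (x * x) = (norm (x::'a::cstar_algebra))\<^sup>2"
  using norm_adj_mult[of x] by simp

lemma norm_square_le_one:
  assumes "norm (x\<^sup>\<dagger> * x) \<le> 1" shows "norm (x::'a::cstar_algebra) \<le> 1"
  using assms power_le_one_iff[of "norm x" 2] by (simp add: norm_adj_mult)

lemma norm_mult_le_one:
  fixes x y :: "'a::real_normed_algebra"
  assumes "norm x \<le> 1" "norm y \<le> 1" shows "norm (x * y) \<le> 1"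
  using norm_mult_ineq[of x y] mult_mono[OF assms] by simp

lemma norm_mean_le_one:
  fixes x y :: "'a::real_normed_vector"
  assumes "norm x \<le> 1" "norm y \<le> 1" shows "norm ((1/2) *\<^sub>R (x + y)) \<le> 1"
  using norm_triangle_ineq[of x y] assms by simp

lemma mult_if_zero: "c * (if P then x else 0) = (if P then c * x else (0::'a::mult_zero))"
  by simp

lemma scaleR_3: "3 *\<^sub>R x = x + x + (x::'a::real_vector)"
  using scaleR_left_distrib[of 1 2 x] by (simp add: scaleR_2)

lemma scaleR_6: "6 *\<^sub>R x = 3 *\<^sub>R x + 3 *\<^sub>R (x::'a::real_vector)"
  using scaleR_left_distrib[of 3 3 x] by simp

text \<open>A selfadjoint \<open>y\<close> with \<open>1 + y\<close> and \<open>1 - y\<close> contractive also has \<open>1 + \<i>y\<close> and \<open>1 - \<i>y\<close> contractive, by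
  the C*-identity and \<open>1 + y\<^sup>2 = ((1 + y)\<^sup>2 + (1 - y)\<^sup>2) / 2\<close>.  Averaging the cubes of the two new
  contractions gives \<open>1 - 3y\<^sup>2\<close>.\<close>

lemma norm_one_minus_three_squares:
  fixes y :: "'a::cstar_algebra"
  assumes "y\<^sup>\<dagger> = y" "norm (1 + y) \<le> 1" "norm (1 - y) \<le> 1"
  shows "norm (1 - 3 *\<^sub>R (y * y)) \<le> 1"
proof -
  define w where "w = \<i> *\<^sub>C y"
  have ww: "w * w = - (y * y)"
    by (simp add: w_def scaleC_mult_left scaleC_mult_right scaleC_scaleC)
  have w_adj: "w\<^sup>\<dagger> = - w"
    by (simp add: w_def adj_scaleC assms)
  have "1 + y * y = (1/2) *\<^sub>R ((1 + y) * (1 + y) + (1 - y) * (1 - y))"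
    by (simp add: algebra_simps flip: scaleR_2)
  hence sq: "norm (1 + y * y) \<le> 1"
    using assms by (simp only: norm_mean_le_one norm_mult_le_one)
  have plus: "norm (1 + w) \<le> 1"
    by (rule norm_square_le_one) (use sq in \<open>simp add: star_simps w_adj ww algebra_simps\<close>)
  have minus: "norm (1 - w) \<le> 1"
    by (rule norm_square_le_one) (use sq in \<open>simp add: star_simps w_adj ww algebra_simps\<close>)
  have "1 - 3 *\<^sub>R (y * y) = 1 + 3 *\<^sub>R (w * w)" by (simp add: ww)
  also have "\<dots> = (1/2) *\<^sub>R ((1 + w) * ((1 + w) * (1 + w)) + (1 - w) * ((1 - w) * (1 - w)))"
  proof -
    have "(1 + w) * ((1 + w) * (1 + w)) + (1 - w) * ((1 - w) * (1 - w)) = 2 *\<^sub>R 1 + 6 *\<^sub>R (w * w)"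
      unfolding scaleR_2 scaleR_6 scaleR_3 by (simp add: algebra_simps)
    thus ?thesis by (simp add: scaleR_right_distrib)
  qed
  finally show ?thesis
    using plus minus by (simp only: norm_mean_le_one norm_mult_le_one)
qed

text \<open>The unit is an extreme point of the unit ball; this is the substitute for the theorem that sums of
  positive elements are positive.  The set \<open>K\<close> of admissible \<open>y\<close> is mapped to itself by
  \<open>f y = (3y + y\<^sup>3) / 2\<close>, since \<open>1 + f y\<close> is the mean of the contractions \<open>(1 + y)\<^sup>3\<close> and
  \<open>1 - 3y\<^sup>2\<close>.  The contraction \<open>1 - 3y\<^sup>2\<close> also bounds the norms of elements of \<open>K\<close> by \<open>\<surd>(2/3)\<close>, and
  under that bound \<open>f\<close> enlarges norms by a factor of at least \<open>7/6\<close>.  Iteration leaves only \<open>y = 0\<close>.\<close>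

lemma one_extreme_point:
  fixes y :: "'a::cstar_algebra"
  assumes "y\<^sup>\<dagger> = y" "norm (1 + y) \<le> 1" "norm (1 - y) \<le> 1"
  shows "y = 0"
proof -
  define K where "K = {y::'a. y\<^sup>\<dagger> = y \<and> norm (1 + y) \<le> 1 \<and> norm (1 - y) \<le> 1}"
  define f where "f = (\<lambda>y::'a. (1/2) *\<^sub>R (3 *\<^sub>R y + y * (y * y)))"
  have small: "(norm z)\<^sup>2 \<le> 2/3" if "z \<in> K" for z
  proof -
    have "norm (3 *\<^sub>R (z * z)) \<le> norm (1 - 3 *\<^sub>R (z * z)) + norm (1::'a)"
      by (metis add_diff_cancel_left' diff_add_cancel norm_minus_commute norm_triangle_ineq4)
    thus ?thesis
      using that norm_one_minus_three_squares[of z]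
      by (auto simp: K_def norm_selfadjoint_square)
  qed
  have f_K: "f z \<in> K" if "z \<in> K" for z
  proof -
    have *: "norm (1 - 3 *\<^sub>R (z * z)) \<le> 1"
      using that norm_one_minus_three_squares[of z] by (simp add: K_def)
    have cube: "(1 + w) * ((1 + w) * (1 + w)) + (1 - 3 *\<^sub>R (w * w))
      = 2 *\<^sub>R 1 + 3 *\<^sub>R w + w * (w * w)" for w :: 'a
      unfolding scaleR_2 scaleR_3 by (simp add: algebra_simps)
    have "1 + f z = (1/2) *\<^sub>R ((1 + z) * ((1 + z) * (1 + z)) + (1 - 3 *\<^sub>R (z * z)))"
      by (simp only: cube f_def) (simp add: scaleR_right_distrib algebra_simps)
    hence "norm (1 + f z) \<le> 1"
      using that * by (simp only: norm_mean_le_one norm_mult_le_one K_def mem_Collect_eq)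
    moreover have "1 - f z = (1/2) *\<^sub>R ((1 - z) * ((1 - z) * (1 - z)) + (1 - 3 *\<^sub>R (z * z)))"
    proof -
      have "(1 - z) * ((1 - z) * (1 - z)) + (1 - 3 *\<^sub>R (z * z)) = 2 *\<^sub>R 1 - 3 *\<^sub>R z - z * (z * z)"
        using cube[of "- z"] by simp
      thus ?thesis
        by (simp only: f_def) (simp add: scaleR_right_distrib scaleR_right_diff_distrib)
    qed
    hence "norm (1 - f z) \<le> 1"
      using that * by (simp only: norm_mean_le_one norm_mult_le_one K_def mem_Collect_eq)
    moreover have "(f z)\<^sup>\<dagger> = f z"
      using that by (simp add: f_def K_def star_simps adj_scaleR mult.assoc)
    ultimately show ?thesis by (simp add: K_def)
  qed
  have grow: "(7/6) * norm z \<le> norm (f z)" if "z \<in> K" for z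
  proof -
    have "norm (z * (z * z)) \<le> norm z * (2/3)"
      using norm_mult_ineq[of z "z * z"] mult_left_mono[OF small[OF that] norm_ge_zero[of z]] that
      by (simp add: K_def norm_selfadjoint_square)
    moreover have "norm (3 *\<^sub>R z) - norm (z * (z * z)) \<le> norm (3 *\<^sub>R z + z * (z * z))"
      by (metis norm_diff_ineq)
    ultimately show ?thesis by (simp add: f_def)
  qed
  have iter: "(f ^^ m) y \<in> K \<and> (7/6)^m * norm y \<le> norm ((f ^^ m) y)" for m
  proof (induction m)
    case 0
    show ?case using assms by (simp add: K_def)
  next
    case (Suc m)
    from Suc grow[of "(f ^^ m) y"] f_K show ?case by (auto simp: algebra_simps)
  qed
  show ?thesis
  proof (rule ccontr)
    assume "y \<noteq> 0"
    obtain m where "1 / norm y < (7/6::real) ^ m"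
      using real_arch_pow[of "7/6::real"] by auto
    with \<open>y \<noteq> 0\<close> have "1 < (7/6) ^ m * norm y" by (simp add: field_simps)
    also have "\<dots> \<le> norm ((f ^^ m) y)" using iter by blast
    finally have "1 < (norm ((f ^^ m) y))\<^sup>2" by (simp add: one_less_power)
    with small[of "(f ^^ m) y"] iter[of m] show False by auto
  qed
qed

lemma cspan_mapI:
  fixes f :: "'a::cstar_algebra \<Rightarrow> 'b::cstar_algebra"
  assumes "\<And>x y. f (x + y) = f x + f y" "\<And>c x. f (c *\<^sub>C x) = c *\<^sub>C f x"
    and "csubspace Y" "\<And>x. x \<in> X \<Longrightarrow> f x \<in> Y" "x \<in> cspan X"
  shows "f x \<in> Y"
proof -
  have "f 0 = 0" using assms(2)[of 0 0] by simp
  hence "csubspace {x. f x \<in> Y}"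
    using assms(1-3) by (simp add: complex_vector.subspace_def)
  with complex_vector.span_induct[OF assms(5)] assms(4) show ?thesis by blast
qed

lemma cspan_one: "x \<in> cspan {1::'a::cstar_algebra} \<longleftrightarrow> (\<exists>c. x = c *\<^sub>C 1)"
  by (auto simp: complex_vector.span_singleton)

lemma unitary_mult: "unitary (a::'a::cstar_algebra) \<Longrightarrow> unitary b \<Longrightarrow> unitary (a * b)"
proof -
  assume "unitary a" "unitary b"
  moreover have "(a * b)\<^sup>\<dagger> * (a * b) = b\<^sup>\<dagger> * (a\<^sup>\<dagger> * a) * b" "(a * b) * (a * b)\<^sup>\<dagger> = a * (b * b\<^sup>\<dagger>) * a\<^sup>\<dagger>"
    by (simp_all add: star_simps mult.assoc)
  ultimately show ?thesis by (simp add: unitary_def)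
qed

lemma unitary_adj: "unitary (a::'a::cstar_algebra) \<Longrightarrow> unitary (a\<^sup>\<dagger>)"
  by (simp add: unitary_def adj_adj)

lemma unitary_cancel:
  assumes "unitary (a::'a::cstar_algebra)" shows "a\<^sup>\<dagger> * (a * x) = x" "a * (a\<^sup>\<dagger> * x) = x"
  using assms unfolding unitary_def by (metis mult.assoc mult.left_neutral)+

lemma unital_endo_sum:
  "unital_endo f \<Longrightarrow> f (\<Sum>i\<in>I. g i) = (\<Sum>i\<in>I. f (g i))"
proof (induction I rule: infinite_finite_induct)
  case empty
  have "f (0 *\<^sub>C 0) = 0 *\<^sub>C f 0"
    using empty unfolding unital_endo_def by blast
  thus ?case by simp
next
  case (infinite A)
  have "f (0 *\<^sub>C 0) = 0 *\<^sub>C f 0"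
    using infinite unfolding unital_endo_def by blast
  thus ?case using infinite by simp
qed (simp_all add: unital_endo_def)


section \<open>Orthogonality of the ranges of the generators\<close>

lemma norm_adj: "norm (x\<^sup>\<dagger>) = norm (x::'a::cstar_algebra)"
proof -
  have "norm z \<le> norm (z\<^sup>\<dagger>)" for z :: 'a
    using norm_mult_ineq[of "z\<^sup>\<dagger>" z]
    by (cases "z = 0") (simp_all add: norm_adj_mult power2_eq_square)
  from this[of x] this[of "x\<^sup>\<dagger>"] show ?thesis by (simp add: adj_adj)
qed

text \<open>For a projection \<open>p\<close>, the element \<open>1 - 2p\<close> is a selfadjoint unitary.\<close>

lemma norm_reflection:
  fixes p :: "'a::cstar_algebra"
  assumes "p * p = p" "p\<^sup>\<dagger> = p" shows "norm (1 - 2 *\<^sub>R p) \<le> 1"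
proof (rule norm_square_le_one)
  have "(1 - 2 *\<^sub>R p) * (1 - 2 *\<^sub>R p) = 1"
    using scaleR_left_distrib[of 2 2 p]
    by (simp add: right_diff_distrib left_diff_distrib scaleR_right_diff_distrib assms(1))
  thus "norm ((1 - 2 *\<^sub>R p)\<^sup>\<dagger> * (1 - 2 *\<^sub>R p)) \<le> 1"
    by (simp add: star_simps adj_scaleR assms(2))
qed

(* Sums and words range over {1..n}; keeping 1 from becoming Suc 0 lets facts about these sums match. *)
declare One_nat_def [simp del]

context cuntz_algebra
begin

lemma isometry [simp]: "i \<in> {1..n} \<Longrightarrow> (S i)\<^sup>\<dagger> * S i = 1"
  using relations by (simp add: cuntz_relations_def)

lemma sum_ranges: "(\<Sum>i=1..n. S i * (S i)\<^sup>\<dagger>) = 1"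
  using relations by (simp add: cuntz_relations_def)

lemma isometry_cancel: "i \<in> {1..n} \<Longrightarrow> (S i)\<^sup>\<dagger> * (S i * x) = x"
  by (metis isometry mult.assoc mult.left_neutral)

lemma norm_isometry: "i \<in> {1..n} \<Longrightarrow> norm (S i) \<le> 1"
  by (rule norm_square_le_one) simp

text \<open>Compressing the reflections in the ranges by \<open>S\<^sub>j\<close> gives contractions \<open>1 - 2 x\<^sub>l\<close>, where the \<open>x\<^sub>l\<close> with
  \<open>l \<noteq> j\<close> sum to \<open>0\<close> because the range projections sum to \<open>1\<close> and \<open>x\<^sub>j = 1\<close>.  So \<open>1\<close> is the mean of
  the \<open>n - 1\<close> contractions with \<open>l \<noteq> j\<close>, and by extremality each of them is \<open>1\<close>.\<close>

lemma orthogonal_ranges: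
  assumes i: "i \<in> {1..n}" and j: "j \<in> {1..n}" and "i \<noteq> j"
  shows "(S i)\<^sup>\<dagger> * S j = 0"
proof -
  define x where "x = (\<lambda>l. (S j)\<^sup>\<dagger> * (S l * (S l)\<^sup>\<dagger>) * S j)"
  define J where "J = {1..n} - {j} - {i}"
  define y where "y = (2 / real n) *\<^sub>R x i"
  have contraction: "norm (1 - 2 *\<^sub>R x l) \<le> 1" if l: "l \<in> {1..n}" for l
  proof -
    let ?s = "1 - 2 *\<^sub>R (S l * (S l)\<^sup>\<dagger>)"
    have "norm ?s \<le> 1"
      by (rule norm_reflection) (simp_all add: star_simps mult.assoc isometry_cancel[OF l])
    moreover have "1 - 2 *\<^sub>R x l = (S j)\<^sup>\<dagger> * (?s * S j)"
      using j by (simp add: x_def algebra_simps)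
    ultimately show ?thesis
      using norm_isometry[OF j] by (simp only: norm_mult_le_one norm_adj)
  qed
  have "(\<Sum>l=1..n. x l) = (S j)\<^sup>\<dagger> * (\<Sum>l=1..n. S l * (S l)\<^sup>\<dagger>) * S j"
    by (simp add: x_def sum_distrib_left sum_distrib_right)
  hence total: "(\<Sum>l=1..n. x l) = 1" using j by (simp add: sum_ranges)
  have "x j = 1"
    using isometry_cancel[OF j] j by (simp add: x_def mult.assoc)
  moreover have "(\<Sum>l=1..n. x l) = x j + (x i + (\<Sum>l\<in>J. x l))"
    unfolding J_def
    using assms sum.remove[OF _ j, of x] sum.remove[of "{1..n} - {j}" i x] by simp
  ultimately have x_i: "x i = - (\<Sum>l\<in>J. x l)"
    using total by (simp add: eq_neg_iff_add_eq_0)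
  have n: "real n > 0" using n_ge_2 by simp
  have card: "real (card J) = real n - 2"
    unfolding J_def using assms n_ge_2 by (simp add: card_Diff_singleton)
  \<comment> \<open>The factor \<open>2 / n\<close> in \<open>y\<close> makes both \<open>1 - y\<close> and \<open>1 + y\<close> convex
    combinations of \<open>1\<close> and the contractions above.\<close>
  have "1 - y = (1 - 1 / real n) *\<^sub>R 1 + (1 / real n) *\<^sub>R (1 - 2 *\<^sub>R x i)"
    by (simp add: y_def algebra_simps)
  hence "norm (1 - y) \<le> (1 - 1 / real n) + (1 / real n) * norm (1 - 2 *\<^sub>R x i)"
    using norm_triangle_ineq[of "(1 - 1 / real n) *\<^sub>R (1::'a)" "(1 / real n) *\<^sub>R (1 - 2 *\<^sub>R x i)"] n_ge_2
    by simp
  also have "\<dots> \<le> 1"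
    using contraction[OF i] n by (simp add: field_simps)
  finally have y1: "norm (1 - y) \<le> 1" .
  have "(\<Sum>l\<in>J. 1 - 2 *\<^sub>R x l) = (real n - 2) *\<^sub>R 1 + 2 *\<^sub>R x i"
    unfolding x_i sum_subtractf
    by (simp add: sum_constant_scaleR card scaleR_right.sum del: sum_constant)
  hence "1 + y = (1 / real n) *\<^sub>R ((\<Sum>l\<in>J. 1 - 2 *\<^sub>R x l) + 2 *\<^sub>R 1)"
    using n by (simp add: y_def algebra_simps)
  hence "norm (1 + y) \<le> (1 / real n) * (norm (\<Sum>l\<in>J. 1 - 2 *\<^sub>R x l) + 2)"
    using n norm_triangle_ineq[of "\<Sum>l\<in>J. 1 - 2 *\<^sub>R x l" "2 *\<^sub>R 1"]
    by (simp add: divide_right_mono)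
  also have "norm (\<Sum>l\<in>J. 1 - 2 *\<^sub>R x l) \<le> real (card J) * 1"
    by (rule sum_norm_bound) (use contraction in \<open>auto simp: J_def\<close>)
  hence "(1 / real n) * (norm (\<Sum>l\<in>J. 1 - 2 *\<^sub>R x l) + 2) \<le> 1"
    using n card by (simp add: field_simps)
  finally have y2: "norm (1 + y) \<le> 1" .
  have "y\<^sup>\<dagger> = y"
    by (simp add: y_def x_def star_simps adj_scaleR mult.assoc)
  with y1 y2 have "y = 0" by (intro one_extreme_point)
  hence "((S i)\<^sup>\<dagger> * S j)\<^sup>\<dagger> * ((S i)\<^sup>\<dagger> * S j) = 0"
    using n by (simp add: y_def x_def star_simps mult.assoc)
  thus ?thesis using norm_adj_mult[of "(S i)\<^sup>\<dagger> * S j"] by simp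
qed

lemma generator_products:
  assumes "i \<in> {1..n}" "j \<in> {1..n}"
  shows "(S i)\<^sup>\<dagger> * S j = (if i = j then 1 else 0)"
    and "(S i)\<^sup>\<dagger> * (S j * z) = (if i = j then z else 0)"
proof -
  show *: "(S i)\<^sup>\<dagger> * S j = (if i = j then 1 else 0)"
    using assms orthogonal_ranges by simp
  show "(S i)\<^sup>\<dagger> * (S j * z) = (if i = j then z else 0)"
    unfolding mult.assoc[symmetric] * by simp
qed

section \<open>Matrix entries with respect to the generators\<close>

text \<open>The products \<open>S\<^sub>i S\<^sub>j\<^sup>\<dagger>\<close> act as matrix units, so an element is determined by its entries
  \<open>S\<^sub>i\<^sup>\<dagger> x S\<^sub>j\<close>, and statements about the core reduce to entries and induction on the level.\<close>

lemma matrix_expansion: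
  "x = (\<Sum>i=1..n. \<Sum>j=1..n. S i * ((S i)\<^sup>\<dagger> * x * S j) * (S j)\<^sup>\<dagger>)"
proof -
  have "x = (\<Sum>i=1..n. S i * (S i)\<^sup>\<dagger>) * (x * (\<Sum>j=1..n. S j * (S j)\<^sup>\<dagger>))"
    by (simp add: sum_ranges)
  also have "\<dots> = (\<Sum>i=1..n. S i * (S i)\<^sup>\<dagger> * (x * (\<Sum>j=1..n. S j * (S j)\<^sup>\<dagger>)))"
    by (rule sum_distrib_right)
  also have "\<dots> = (\<Sum>i=1..n. \<Sum>j=1..n. S i * ((S i)\<^sup>\<dagger> * x * S j) * (S j)\<^sup>\<dagger>)"
    by (simp add: sum_distrib_left mult.assoc)
  finally show ?thesis .
qed

lemma matrix_eqI:
  assumes "\<And>i j. i \<in> {1..n} \<Longrightarrow> j \<in> {1..n} \<Longrightarrow> (S i)\<^sup>\<dagger> * x * S j = (S i)\<^sup>\<dagger> * y * S j"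
  shows "x = y"
proof -
  have "(\<Sum>i=1..n. \<Sum>j=1..n. S i * ((S i)\<^sup>\<dagger> * x * S j) * (S j)\<^sup>\<dagger>)
      = (\<Sum>i=1..n. \<Sum>j=1..n. S i * ((S i)\<^sup>\<dagger> * y * S j) * (S j)\<^sup>\<dagger>)"
    by (intro sum.cong refl) (simp only: assms)
  thus ?thesis by (simp only: flip: matrix_expansion)
qed

lemma mult_via_generators: "x * y = (\<Sum>l=1..n. x * S l * ((S l)\<^sup>\<dagger> * y))"
proof -
  have "x * y = x * (\<Sum>l=1..n. S l * (S l)\<^sup>\<dagger>) * y" by (simp add: sum_ranges)
  also have "\<dots> = (\<Sum>l=1..n. x * S l * ((S l)\<^sup>\<dagger> * y))"
    by (simp only: sum_distrib_left sum_distrib_right mult.assoc)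
  finally show ?thesis .
qed

abbreviation \<phi> where "\<phi> \<equiv> phi n S"

lemma phi_S: "i \<in> {1..n} \<Longrightarrow> \<phi> a * S i = S i * a"
  unfolding phi_def sum_distrib_right
  by (simp add: mult.assoc generator_products mult_if_zero)

lemma adj_S_phi: "i \<in> {1..n} \<Longrightarrow> (S i)\<^sup>\<dagger> * \<phi> a = a * (S i)\<^sup>\<dagger>"
  unfolding phi_def sum_distrib_left
  by (simp add: mult.assoc generator_products mult_if_zero)

lemma phi_mult: "\<phi> (a * b) = \<phi> a * \<phi> b"
proof -
  have "\<phi> a * \<phi> b = (\<Sum>i=1..n. (\<phi> a * S i) * b * (S i)\<^sup>\<dagger>)"
    by (simp add: phi_def[of _ _ b] sum_distrib_left mult.assoc)
  also have "\<dots> = (\<Sum>i=1..n. S i * (a * b) * (S i)\<^sup>\<dagger>)"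
    by (intro sum.cong refl) (simp add: phi_S mult.assoc)
  finally show ?thesis by (simp only: phi_def[of _ _ "a * b"])
qed

lemma phi_one: "\<phi> 1 = 1"
  by (simp add: phi_def sum_ranges)

lemma phi_adj: "\<phi> (a\<^sup>\<dagger>) = (\<phi> a)\<^sup>\<dagger>"
  by (simp add: phi_def star_simps mult.assoc)

lemma phi_iter_adj: "(\<phi> ^^ m) (a\<^sup>\<dagger>) = ((\<phi> ^^ m) a)\<^sup>\<dagger>"
  by (induction m) (simp_all add: phi_adj)

lemma unitary_phi: "unitary a \<Longrightarrow> unitary (\<phi> a)"
  by (simp add: unitary_def phi_one flip: phi_adj phi_mult)

section \<open>The matrix algebras in the core\<close>

lemma subspace_core [simp]: "csubspace (core n S r)"
  by (simp add: core_def)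

lemma core_0: "core n S 0 = cspan {1}"
  by (simp add: core_def words_def S_word_def conj_commute cong: conj_cong)

text \<open>This recursion replaces the description by spanning words: closure properties of the matrix
  algebras follow from it by induction, with scalars as the base case.\<close>

lemma core_Suc:
  "x \<in> core n S (Suc r) \<longleftrightarrow> (\<forall>i\<in>{1..n}. \<forall>j\<in>{1..n}. (S i)\<^sup>\<dagger> * x * S j \<in> core n S r)"
proof
  assume x: "x \<in> core n S (Suc r)"
  show "\<forall>i\<in>{1..n}. \<forall>j\<in>{1..n}. (S i)\<^sup>\<dagger> * x * S j \<in> core n S r"
  proof (intro ballI)
    fix i j assume i: "i \<in> {1..n}" and j: "j \<in> {1..n}"
    show "(S i)\<^sup>\<dagger> * x * S j \<in> core n S r"
    proof (rule cspan_mapI[where f = "\<lambda>x. (S i)\<^sup>\<dagger> * x * S j"])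
      fix y assume "y \<in> {S_word S \<alpha> * (S_word S \<beta>)\<^sup>\<dagger> | \<alpha> \<beta>. \<alpha> \<in> words n (Suc r) \<and> \<beta> \<in> words n (Suc r)}"
      then obtain a \<alpha> b \<beta> where ab: "a \<in> {1..n}" "\<alpha> \<in> words n r" "b \<in> {1..n}" "\<beta> \<in> words n r"
        and y: "y = S_word S (a # \<alpha>) * (S_word S (b # \<beta>))\<^sup>\<dagger>"
        by (auto simp: words_def length_Suc_conv)
      have "S_word S \<alpha> * (S_word S \<beta>)\<^sup>\<dagger> \<in> core n S r"
        unfolding core_def using ab by (intro complex_vector.span_base) blast
      moreover have "(S i)\<^sup>\<dagger> * y * S j =
          (if i = a \<and> b = j then S_word S \<alpha> * (S_word S \<beta>)\<^sup>\<dagger> else 0)"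
        using ab i j by (simp add: y S_word_def star_simps mult.assoc generator_products)
      ultimately show "(S i)\<^sup>\<dagger> * y * S j \<in> core n S r"
        by (simp add: complex_vector.subspace_0)
    qed (use x in \<open>simp_all add: core_def distrib_left distrib_right scaleC_mult_left scaleC_mult_right\<close>)
  qed
next
  assume entries: "\<forall>i\<in>{1..n}. \<forall>j\<in>{1..n}. (S i)\<^sup>\<dagger> * x * S j \<in> core n S r"
  have "S i * y * (S j)\<^sup>\<dagger> \<in> core n S (Suc r)"
    if "y \<in> core n S r" "i \<in> {1..n}" "j \<in> {1..n}" for y i j
  proof (rule cspan_mapI[where f = "\<lambda>y. S i * y * (S j)\<^sup>\<dagger>"])
    fix y assume "y \<in> {S_word S \<alpha> * (S_word S \<beta>)\<^sup>\<dagger> | \<alpha> \<beta>. \<alpha> \<in> words n r \<and> \<beta> \<in> words n r}"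
    then obtain \<alpha> \<beta> where ab: "\<alpha> \<in> words n r" "\<beta> \<in> words n r"
      and y: "y = S_word S \<alpha> * (S_word S \<beta>)\<^sup>\<dagger>" by blast
    have "S i * y * (S j)\<^sup>\<dagger> = S_word S (i # \<alpha>) * (S_word S (j # \<beta>))\<^sup>\<dagger>"
      by (simp add: y S_word_def star_simps mult.assoc)
    moreover have "i # \<alpha> \<in> words n (Suc r)" "j # \<beta> \<in> words n (Suc r)"
      using ab that by (auto simp: words_def)
    ultimately show "S i * y * (S j)\<^sup>\<dagger> \<in> core n S (Suc r)"
      unfolding core_def by (intro complex_vector.span_base) blast
  qed (use that in \<open>simp_all add: core_def distrib_left distrib_right scaleC_mult_left scaleC_mult_right\<close>)
  with entries show "x \<in> core n S (Suc r)"
    by (subst matrix_expansion[of x]) (intro complex_vector.subspace_sum, auto)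
qed

lemma core_mult: "x \<in> core n S r \<Longrightarrow> y \<in> core n S r \<Longrightarrow> x * y \<in> core n S r"
proof (induction r arbitrary: x y)
  case 0
  thus ?case by (auto simp: core_0 cspan_one scaleC_mult_left scaleC_scaleC)
next
  case (Suc r)
  have "(S i)\<^sup>\<dagger> * (x * y) * S j = (\<Sum>l=1..n. (S i)\<^sup>\<dagger> * x * S l * ((S l)\<^sup>\<dagger> * y * S j))" for i j
    using mult_via_generators[of "(S i)\<^sup>\<dagger> * x" "y * S j"] by (simp add: mult.assoc)
  thus ?case
    using Suc by (auto simp: core_Suc intro!: complex_vector.subspace_sum)
qed

lemma core_adj: "x \<in> core n S r \<Longrightarrow> x\<^sup>\<dagger> \<in> core n S r"
proof (induction r arbitrary: x)
  case 0
  thus ?case by (auto simp: core_0 cspan_one adj_scaleC)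
next
  case (Suc r)
  have adj: "(S i)\<^sup>\<dagger> * x\<^sup>\<dagger> * S j = ((S j)\<^sup>\<dagger> * x * S i)\<^sup>\<dagger>" for i j
    by (simp add: star_simps mult.assoc)
  show ?case unfolding core_Suc adj using Suc by (simp add: core_Suc)
qed

lemma one_in_core: "1 \<in> core n S r"
proof (induction r)
  case 0
  show ?case by (simp add: core_0 complex_vector.span_base)
next
  case (Suc r)
  thus ?case by (simp add: core_Suc generator_products complex_vector.subspace_0)
qed

lemma core_mono: "r \<le> s \<Longrightarrow> core n S r \<subseteq> core n S s"
proof (rule lift_Suc_mono_le)
  fix r
  have "x \<in> core n S (Suc r)" if "x \<in> core n S r" for x using that
  proof (induction r arbitrary: x)
    case 0
    then obtain c where "x = c *\<^sub>C 1" by (auto simp: core_0 cspan_one)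
    thus ?case
      using one_in_core[of "Suc 0"] by (auto intro: complex_vector.subspace_scale)
  qed (simp add: core_Suc)
  thus "core n S r \<subseteq> core n S (Suc r)" by blast
qed

lemma core_phi: "x \<in> core n S r \<Longrightarrow> \<phi> x \<in> core n S (Suc r)"
  by (auto simp: core_Suc mult.assoc phi_S generator_products complex_vector.subspace_0)

lemma core_phi_iter: "x \<in> core n S r \<Longrightarrow> (\<phi> ^^ j) x \<in> core n S (r + j)"
  by (induction j) (simp_all add: core_phi)

text \<open>The relative commutant property \<open>\<phi>\<^sup>j(a) \<in> (\<F>\<^sup>r)'\<close> for \<open>j \<ge> r\<close>: in the entries, one power of \<open>\<phi>\<close> is
  absorbed by passing it through a generator while the level of \<open>x\<close> drops by one.\<close>

lemma core_commutes:
  "x \<in> core n S r \<Longrightarrow> r \<le> j \<Longrightarrow> x * (\<phi> ^^ j) a = (\<phi> ^^ j) a * x"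
proof (induction r arbitrary: x j)
  case 0
  thus ?case by (auto simp: core_0 cspan_one scaleC_mult_left scaleC_mult_right)
next
  case (Suc r)
  then obtain j' where j: "j = Suc j'" "r \<le> j'" by (cases j) auto
  show ?case
  proof (rule matrix_eqI)
    fix i l assume i: "i \<in> {1..n}" and l: "l \<in> {1..n}"
    have "(S i)\<^sup>\<dagger> * (x * \<phi> ((\<phi> ^^ j') a)) * S l = ((S i)\<^sup>\<dagger> * x * S l) * (\<phi> ^^ j') a"
      by (simp add: mult.assoc phi_S[OF l])
    also have "\<dots> = (\<phi> ^^ j') a * ((S i)\<^sup>\<dagger> * x * S l)"
      using Suc i l j by (intro Suc.IH) (auto simp: core_Suc)
    also have "\<dots> = (S i)\<^sup>\<dagger> * (\<phi> ((\<phi> ^^ j') a) * x) * S l"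
      by (simp add: adj_S_phi[OF i] flip: mult.assoc)
    finally show "(S i)\<^sup>\<dagger> * (x * (\<phi> ^^ j) a) * S l = (S i)\<^sup>\<dagger> * ((\<phi> ^^ j) a * x) * S l"
      by (simp add: j)
  qed
qed

lemma words_Suc: "words n (Suc r) = {i # \<alpha> | i \<alpha>. i \<in> {1..n} \<and> \<alpha> \<in> words n r}"
  by (auto simp: words_def length_Suc_conv)

text \<open>With \<open>s = 0\<close> this says that an element has level \<open>r\<close> if and only if its entries at words of length
  \<open>r\<close> are scalar.\<close>

lemma core_add_iff:
  "x \<in> core n S (r + s) \<longleftrightarrow>
     (\<forall>\<alpha>\<in>words n r. \<forall>\<beta>\<in>words n r. (S_word S \<alpha>)\<^sup>\<dagger> * x * S_word S \<beta> \<in> core n S s)"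
proof (induction r arbitrary: x)
  case 0
  show ?case by (simp add: words_def S_word_def)
next
  case (Suc r)
  have entry: "(S_word S (i # \<alpha>))\<^sup>\<dagger> * x * S_word S (j # \<beta>)
      = (S_word S \<alpha>)\<^sup>\<dagger> * ((S i)\<^sup>\<dagger> * x * S j) * S_word S \<beta>" for i j \<alpha> \<beta>
    by (simp add: S_word_def star_simps mult.assoc)
  have "x \<in> core n S (Suc r + s) \<longleftrightarrow> (\<forall>i\<in>{1..n}. \<forall>j\<in>{1..n}. \<forall>\<alpha>\<in>words n r. \<forall>\<beta>\<in>words n r.
      (S_word S (i # \<alpha>))\<^sup>\<dagger> * x * S_word S (j # \<beta>) \<in> core n S s)"
    unfolding entry by (simp add: core_Suc Suc.IH)
  also have "\<dots> \<longleftrightarrow> (\<forall>\<alpha>\<in>words n (Suc r). \<forall>\<beta>\<in>words n (Suc r).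
      (S_word S \<alpha>)\<^sup>\<dagger> * x * S_word S \<beta> \<in> core n S s)"
    unfolding words_Suc by blast
  finally show ?case .
qed

section \<open>The unitaries implementing an endomorphism on the core\<close>

definition U :: "'a \<Rightarrow> nat \<Rightarrow> 'a" where
  "U u r = prod_list (map (\<lambda>j. (\<phi> ^^ j) u) (rev [0..<r]))"

lemma U_0 [simp]: "U u 0 = 1"
  by (simp add: U_def)

lemma U_Suc: "U u (Suc r) = (\<phi> ^^ r) u * U u r"
  by (simp add: U_def)

lemma u_prod_eq: "u_prod n S u m = U u (Suc m)"
  by (simp only: u_prod_def U_def)

text \<open>The definition peels off the left factor; peeling off the right one makes induction on the entries
  with respect to the generators possible.\<close>

lemma U_Suc_phi: "U u (Suc r) = \<phi> (U u r) * u"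
proof (induction r)
  case (Suc r)
  have "U u (Suc (Suc r)) = \<phi> ((\<phi> ^^ r) u) * (\<phi> (U u r) * u)"
    by (subst U_Suc) (simp only: Suc funpow.simps comp_apply)
  thus ?case by (simp only: U_Suc phi_mult mult.assoc)
qed (simp add: U_def phi_one)

lemma unitary_U: "unitary u \<Longrightarrow> unitary (U u r)"
  by (induction r) (simp_all add: U_Suc_phi unitary_mult unitary_phi, simp add: unitary_def)

lemma U_in_core: "u \<in> core n S k \<Longrightarrow> U u r \<in> core n S (k + r)"
proof (induction r)
  case (Suc r)
  have "(\<phi> ^^ r) u \<in> core n S (k + Suc r)" "U u r \<in> core n S (k + Suc r)"
    using Suc core_phi_iter[of u k r] core_mono[of "k + r" "k + Suc r"] by auto
  thus ?case by (simp only: U_Suc core_mult)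
qed (simp add: one_in_core)

text \<open>Once \<open>U r x (U r)\<^sup>\<dagger>\<close> is of level \<open>r\<close>, it commutes with the further factors \<open>\<phi>\<^sup>m(u)\<close>, \<open>m \<ge> r\<close>.\<close>

lemma conj_U_stable:
  assumes "U u r * x * (U u r)\<^sup>\<dagger> \<in> core n S r" "unitary u" "r \<le> m"
  shows "U u m * x * (U u m)\<^sup>\<dagger> = U u r * x * (U u r)\<^sup>\<dagger>"
  using assms(3)
proof (induction m rule: dec_induct)
  case (step m)
  let ?p = "(\<phi> ^^ m) u"
  have "unitary ?p"
    using assms(2) by (induction m) (simp_all add: unitary_phi)
  have "U u (Suc m) * x * (U u (Suc m))\<^sup>\<dagger> = ?p * (U u m * x * (U u m)\<^sup>\<dagger>) * ?p\<^sup>\<dagger>"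
    by (simp add: U_Suc star_simps mult.assoc)
  also have "\<dots> = (U u r * x * (U u r)\<^sup>\<dagger>) * (?p * ?p\<^sup>\<dagger>)"
    by (simp only: step.IH core_commutes[OF assms(1) step(1), of u, symmetric] mult.assoc[of _ ?p])
  finally show ?case using \<open>unitary ?p\<close> by (simp add: unitary_def)
qed simp

section \<open>Endomorphisms attached to unitaries\<close>

text \<open>The elements \<open>u\<^sup>\<dagger> S\<^sub>i\<close> satisfy the Cuntz relations, so the description defining \<open>lam\<close> denotes.\<close>

lemma lam_ex1:
  assumes "unitary u"
  shows "\<exists>!f. unital_endo f \<and> (\<forall>i\<in>{1..n}. f (S i) = u\<^sup>\<dagger> * S i)"
proof (rule universal)
  have "(\<Sum>i=1..n. u\<^sup>\<dagger> * S i * (u\<^sup>\<dagger> * S i)\<^sup>\<dagger>) = u\<^sup>\<dagger> * (\<Sum>i=1..n. S i * (S i)\<^sup>\<dagger>) * u"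
    by (simp add: star_simps sum_distrib_left sum_distrib_right mult.assoc)
  thus "cuntz_relations n (\<lambda>i. u\<^sup>\<dagger> * S i)"
    unfolding cuntz_relations_def sum_ranges using assms
    by (simp add: star_simps mult.assoc unitary_cancel) (simp add: unitary_def)
qed

lemma
  assumes "unitary u"
  shows lam_endo: "unital_endo (lam n S u)"
    and lam_S: "i \<in> {1..n} \<Longrightarrow> lam n S u (S i) = u\<^sup>\<dagger> * S i"
  using theI'[OF lam_ex1[OF assms]] unfolding lam_def[symmetric] by simp_all

lemma lam_unique:
  assumes "unitary u" "unital_endo f" "\<And>i. i \<in> {1..n} \<Longrightarrow> f (S i) = u\<^sup>\<dagger> * S i"
  shows "f = lam n S u"
  using lam_ex1[OF assms(1)] assms
    lam_endo[OF assms(1)] lam_S[OF assms(1)] by blast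

lemma lam_one: "lam n S 1 = id"
  by (rule lam_unique[symmetric]) (simp_all add: unitary_def unital_endo_def)

lemma endo_simps:
  assumes "unital_endo f"
  shows "f (x + y) = f x + f y" "f (x * y) = f x * f y" "f (c *\<^sub>C x) = c *\<^sub>C f x"
    "f (x\<^sup>\<dagger>) = (f x)\<^sup>\<dagger>" "f 1 = 1"
  using assms by (simp_all add: unital_endo_def)

text \<open>The formula passes from level \<open>r\<close> to \<open>r + 1\<close> because \<open>S\<^sub>i (U r)\<^sup>\<dagger> = \<phi>((U r)\<^sup>\<dagger>) S\<^sub>i\<close> and
  \<open>U (r + 1) = \<phi>(U r) u\<close>.\<close>

lemma lam_core:
  assumes u: "unitary u"
  shows "x \<in> core n S r \<Longrightarrow> lam n S u x = (U u r)\<^sup>\<dagger> * x * U u r"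
proof (induction r arbitrary: x)
  case 0
  thus ?case by (auto simp: core_0 cspan_one endo_simps[OF lam_endo[OF u]])
next
  case (Suc r)
  have "lam n S u (S i * y * (S j)\<^sup>\<dagger>) = (U u (Suc r))\<^sup>\<dagger> * (S i * y * (S j)\<^sup>\<dagger>) * U u (Suc r)"
    if "y \<in> core n S r" and i: "i \<in> {1..n}" and j: "j \<in> {1..n}" for y i j
  proof -
    have "lam n S u (S i * y * (S j)\<^sup>\<dagger>) = u\<^sup>\<dagger> * (S i * (U u r)\<^sup>\<dagger>) * y * (U u r * (S j)\<^sup>\<dagger>) * u"
      using that u Suc.IH
      by (simp add: endo_simps[OF lam_endo[OF u]] lam_S star_simps mult.assoc)
    also have "S i * (U u r)\<^sup>\<dagger> = \<phi> ((U u r)\<^sup>\<dagger>) * S i" by (rule phi_S[OF i, symmetric])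
    also have "U u r * (S j)\<^sup>\<dagger> = (S j)\<^sup>\<dagger> * \<phi> (U u r)" by (rule adj_S_phi[OF j, symmetric])
    finally show ?thesis by (simp add: U_Suc_phi star_simps phi_adj mult.assoc)
  qed
  hence "lam n S u (S i * ((S i)\<^sup>\<dagger> * x * S j) * (S j)\<^sup>\<dagger>)
      = (U u (Suc r))\<^sup>\<dagger> * (S i * ((S i)\<^sup>\<dagger> * x * S j) * (S j)\<^sup>\<dagger>) * U u (Suc r)"
    if "i \<in> {1..n}" "j \<in> {1..n}" for i j
    using Suc.prems that by (simp only: core_Suc)
  hence "lam n S u x = (\<Sum>i=1..n. \<Sum>j=1..n.
      (U u (Suc r))\<^sup>\<dagger> * (S i * ((S i)\<^sup>\<dagger> * x * S j) * (S j)\<^sup>\<dagger>) * U u (Suc r))"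
    by (subst matrix_expansion[of x]) (simp only: unital_endo_sum[OF lam_endo[OF u]] cong: sum.cong)
  also have "\<dots> = (U u (Suc r))\<^sup>\<dagger> *
      (\<Sum>i=1..n. \<Sum>j=1..n. S i * ((S i)\<^sup>\<dagger> * x * S j) * (S j)\<^sup>\<dagger>) * U u (Suc r)"
    by (simp only: sum_distrib_left sum_distrib_right)
  finally show ?case by (simp only: flip: matrix_expansion)
qed

text \<open>The composite sends \<open>S\<^sub>i\<close> to \<open>(\<lambda>\<^sub>u(v))\<^sup>\<dagger> u\<^sup>\<dagger> S\<^sub>i\<close>, and an endomorphism that fixes the generators is
  the identity.\<close>

lemma lam_inverse_iff:
  assumes u: "unitary u" and v: "unitary v"
  shows "lam n S u \<circ> lam n S v = id \<longleftrightarrow> lam n S u v = u\<^sup>\<dagger>"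
proof
  assume "lam n S u v = u\<^sup>\<dagger>"
  hence "(lam n S u \<circ> lam n S v) (S i) = 1\<^sup>\<dagger> * S i" if "i \<in> {1..n}" for i
    using that u v by (simp add: lam_S endo_simps[OF lam_endo[OF u]] unitary_cancel adj_adj)
  moreover have "unital_endo (lam n S u \<circ> lam n S v)"
    using lam_endo[OF u] lam_endo[OF v] by (simp add: unital_endo_def)
  ultimately have "lam n S u \<circ> lam n S v = lam n S 1"
    by (intro lam_unique) (simp_all add: unitary_def)
  thus "lam n S u \<circ> lam n S v = id" by (simp add: lam_one)
next
  assume inv: "lam n S u \<circ> lam n S v = id"
  let ?w = "(lam n S u v)\<^sup>\<dagger> * u\<^sup>\<dagger>"
  have fixes_S: "?w * S i = S i" if "i \<in> {1..n}" for i
  proof -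
    have "lam n S u (lam n S v (S i)) = S i" using fun_cong[OF inv, of "S i"] by simp
    thus ?thesis
      using that u v by (simp add: lam_S endo_simps[OF lam_endo[OF u]] mult.assoc)
  qed
  have "?w = 1"
    by (rule matrix_eqI) (simp add: mult.assoc[of _ ?w] fixes_S)
  moreover have "(lam n S u v)\<^sup>\<dagger> = ?w * u"
    using u by (simp add: mult.assoc unitary_def)
  ultimately have "(lam n S u v)\<^sup>\<dagger> = u" by simp
  thus "lam n S u v = u\<^sup>\<dagger>" by (metis adj_adj)
qed

lemma lam_inj_core:
  assumes u: "unitary u" and "x \<in> core n S r" "y \<in> core n S s" "lam n S u x = lam n S u y"
  shows "x = y"
proof -
  let ?m = "max r s"
  have "x \<in> core n S ?m" "y \<in> core n S ?m"
    using assms core_mono[of r ?m] core_mono[of s ?m] by auto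
  hence eq: "(U u ?m)\<^sup>\<dagger> * x * U u ?m = (U u ?m)\<^sup>\<dagger> * y * U u ?m"
    using assms lam_core[OF u] by metis
  have "z = U u ?m * ((U u ?m)\<^sup>\<dagger> * z * U u ?m) * (U u ?m)\<^sup>\<dagger>" for z
    using unitary_U[OF u] by (simp add: unitary_cancel mult.assoc) (simp add: unitary_def)
  thus ?thesis using eq by metis
qed

lemma lam_maps_core:
  assumes v: "unitary v" "v \<in> core n S h" and "x \<in> core n S r"
  shows "lam n S v x \<in> core n S (h + r)"
proof -
  have "U v r \<in> core n S (h + r)" "x \<in> core n S (h + r)"
    using assms U_in_core core_mono[of r "h + r"] by auto
  thus ?thesis
    unfolding lam_core[OF v(1) assms(3)] by (intro core_mult core_adj)
qed

text \<open>The equation \<open>\<lambda>\<^sub>u(v) = u\<^sup>\<dagger>\<close> only provides a right inverse.  For a left inverse \<open>\<lambda>\<^sub>v(u) = v\<^sup>\<dagger>\<close> is needed;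
  both sides lie in matrix algebras and have the same image \<open>u\<close> under \<open>\<lambda>\<^sub>u\<close>, which is injective there.\<close>

lemma localized_inverse_iff:
  assumes u: "unitary u" "u \<in> core n S k"
  shows "bij (lam n S u) \<and> localized n S (inv (lam n S u))
    \<longleftrightarrow> (\<exists>h v. unitary v \<and> v \<in> core n S h \<and> lam n S u v = u\<^sup>\<dagger>)"
proof
  assume "bij (lam n S u) \<and> localized n S (inv (lam n S u))"
  then obtain h v where v: "unitary v" "v \<in> core n S h" and
    inv: "bij (lam n S u)" "inv (lam n S u) = lam n S v"
    by (auto simp: localized_def)
  hence "lam n S u \<circ> lam n S v = id"
    by (metis bij_is_surj surj_iff)
  with v lam_inverse_iff[OF u(1)] show "\<exists>h v. unitary v \<and> v \<in> core n S h \<and> lam n S u v = u\<^sup>\<dagger>"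
    by blast
next
  assume "\<exists>h v. unitary v \<and> v \<in> core n S h \<and> lam n S u v = u\<^sup>\<dagger>"
  then obtain h v where v: "unitary v" "v \<in> core n S h" and uv: "lam n S u v = u\<^sup>\<dagger>" by blast
  have right: "lam n S u \<circ> lam n S v = id"
    using lam_inverse_iff u(1) v(1) uv by blast
  have "lam n S u (lam n S v u) = u"
    using fun_cong[OF right, of u] by simp
  also have "u = lam n S u (v\<^sup>\<dagger>)"
    by (simp add: endo_simps[OF lam_endo[OF u(1)]] uv adj_adj)
  finally have "lam n S v u = v\<^sup>\<dagger>"
    using lam_inj_core[OF u(1) lam_maps_core[OF v u(2)] core_adj[OF v(2)]] by blast
  hence left: "lam n S v \<circ> lam n S u = id"
    using lam_inverse_iff u(1) v(1) by blast
  have "bij (lam n S u)" using left right by (rule o_bij)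
  moreover have "inv (lam n S u) = lam n S v" using right left by (rule inv_unique_comp)
  ultimately show "bij (lam n S u) \<and> localized n S (inv (lam n S u))"
    using v by (auto simp: localized_def)
qed

text \<open>The link between inverses and the sequence of unitaries: at level \<open>r\<close> the equation \<open>\<lambda>\<^sub>u(v) = u\<^sup>\<dagger>\<close> can be
  solved for \<open>v\<close>.\<close>

lemma lam_eq_adj_iff:
  assumes u: "unitary u" and "v \<in> core n S r"
  shows "lam n S u v = u\<^sup>\<dagger> \<longleftrightarrow> Ad (U u r) (u\<^sup>\<dagger>) = v"
proof -
  have U: "(U u r)\<^sup>\<dagger> * U u r = 1" "U u r * (U u r)\<^sup>\<dagger> = 1"
    using unitary_U[OF u] by (simp_all add: unitary_def)
  have "(U u r)\<^sup>\<dagger> * v * U u r = u\<^sup>\<dagger> \<longleftrightarrow> U u r * u\<^sup>\<dagger> * (U u r)\<^sup>\<dagger> = v"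
  proof
    assume "(U u r)\<^sup>\<dagger> * v * U u r = u\<^sup>\<dagger>"
    hence "U u r * u\<^sup>\<dagger> * (U u r)\<^sup>\<dagger> = (U u r * (U u r)\<^sup>\<dagger>) * v * (U u r * (U u r)\<^sup>\<dagger>)"
      by (metis mult.assoc)
    thus "U u r * u\<^sup>\<dagger> * (U u r)\<^sup>\<dagger> = v" by (simp add: U)
  next
    assume "U u r * u\<^sup>\<dagger> * (U u r)\<^sup>\<dagger> = v"
    hence "(U u r)\<^sup>\<dagger> * v * U u r = ((U u r)\<^sup>\<dagger> * U u r) * u\<^sup>\<dagger> * ((U u r)\<^sup>\<dagger> * U u r)"
      by (metis mult.assoc)
    thus "(U u r)\<^sup>\<dagger> * v * U u r = u\<^sup>\<dagger>" by (simp add: U)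
  qed
  thus ?thesis by (simp add: lam_core[OF u assms(2)] Ad_def)
qed

lemma stabilizes_iff:
  assumes u: "unitary u" "u \<in> core n S k"
  shows "(\<exists>c. \<forall>\<^sub>F m in sequentially. Ad (u_prod n S u m) (u\<^sup>\<dagger>) = c)
    \<longleftrightarrow> (\<exists>h v. unitary v \<and> v \<in> core n S h \<and> lam n S u v = u\<^sup>\<dagger>)"
proof
  assume "\<exists>c. \<forall>\<^sub>F m in sequentially. Ad (u_prod n S u m) (u\<^sup>\<dagger>) = c"
  then obtain c N where c: "\<And>m. m \<ge> N \<Longrightarrow> Ad (U u (Suc m)) (u\<^sup>\<dagger>) = c"
    by (auto simp: eventually_sequentially u_prod_eq)
  \<comment> \<open>The limit \<open>c\<close> equals an early term, hence has a level; a later term, whose index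
    exceeds that level, then exhibits \<open>c\<close> as a solution of \<open>\<lambda>\<^sub>u(c) = u\<^sup>\<dagger>\<close>.\<close>
  have "u \<in> core n S (k + Suc N)" using u core_mono[of k "k + Suc N"] by auto
  hence "Ad (U u (Suc N)) (u\<^sup>\<dagger>) \<in> core n S (k + Suc N)"
    unfolding Ad_def using u by (intro core_mult core_adj U_in_core)
  hence c_core: "c \<in> core n S (Suc (k + N))" by (simp add: c)
  moreover have "unitary c"
    unfolding c[OF order_refl, symmetric] Ad_def
    by (intro unitary_mult unitary_adj unitary_U u)
  moreover have "lam n S u c = u\<^sup>\<dagger>"
    using c[of "k + N"] lam_eq_adj_iff[OF u(1) c_core] by simp
  ultimately show "\<exists>h v. unitary v \<and> v \<in> core n S h \<and> lam n S u v = u\<^sup>\<dagger>" by blast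
next
  assume "\<exists>h v. unitary v \<and> v \<in> core n S h \<and> lam n S u v = u\<^sup>\<dagger>"
  then obtain h v where v: "v \<in> core n S h" "lam n S u v = u\<^sup>\<dagger>" by blast
  have "Ad (U u (Suc m)) (u\<^sup>\<dagger>) = v" if "m \<ge> h" for m
    using that v lam_eq_adj_iff[OF u(1), of v "Suc m"] core_mono[of h "Suc m"] by auto
  thus "\<exists>c. \<forall>\<^sub>F m in sequentially. Ad (u_prod n S u m) (u\<^sup>\<dagger>) = c"
    by (auto simp: eventually_sequentially u_prod_eq)
qed

end

section \<open>The algebra B and the spaces Xi\<close>

locale core_unitary = cuntz_algebra n S for n and S :: "nat \<Rightarrow> 'a::cstar_algebra" +
  fixes k :: nat and u :: 'a
  assumes k_ge_1: "k \<ge> 1" and unitary_u: "unitary u" and u_core: "u \<in> core n S k"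
begin

abbreviation "B \<equiv> B_alg n S k u"
abbreviation "F \<equiv> core n S (k - 1)"
abbreviation "X \<equiv> Xi n S k u"

lemma B_subset: "B \<subseteq> F"
  using k_ge_1 by (auto simp: B_alg_def core_0)

text \<open>The definition of \<open>B\<close> only demands this for \<open>j \<le> k - 2\<close>; for larger \<open>j\<close> it holds on all of \<open>F\<close>.\<close>

lemma B_commutes: "x \<in> B \<Longrightarrow> x * (\<phi> ^^ j) u = (\<phi> ^^ j) u * x"
proof (cases "k \<ge> 2 \<and> j \<le> k - 2")
  case True
  thus "x \<in> B \<Longrightarrow> ?thesis" by (auto simp: B_alg_def commutant_def)
next
  case False
  hence "k - 1 \<le> j" using k_ge_1 by auto
  thus "x \<in> B \<Longrightarrow> ?thesis" using B_subset core_commutes by blast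
qed

lemma subspace_B [simp]: "csubspace B"
proof -
  have "csubspace (commutant Y)" for Y :: "'a set"
    by (simp add: complex_vector.subspace_def commutant_def distrib_left distrib_right
        scaleC_mult_left scaleC_mult_right)
  thus ?thesis by (simp add: B_alg_def complex_vector.subspace_inter)
qed

lemma one_in_B: "1 \<in> B"
  by (simp add: B_alg_def commutant_def one_in_core complex_vector.span_base)

lemma span_one_subset_B: "cspan {1} \<subseteq> B"
  by (rule complex_vector.span_minimal) (simp_all add: one_in_B)

lemma conj_U_B: "x \<in> B \<Longrightarrow> U u r * x * (U u r)\<^sup>\<dagger> = x"
proof -
  assume x: "x \<in> B"
  have comm: "U u r * x = x * U u r"
  proof (induction r)
    case (Suc r)
    have "U u (Suc r) * x = (\<phi> ^^ r) u * (U u r * x)" by (simp only: U_Suc mult.assoc)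
    also have "\<dots> = ((\<phi> ^^ r) u * x) * U u r" by (simp only: Suc mult.assoc)
    also have "\<dots> = x * U u (Suc r)"
      by (simp only: B_commutes[OF x, symmetric] U_Suc mult.assoc)
    finally show ?case .
  qed simp
  show ?thesis
    unfolding comm mult.assoc using unitary_U[OF unitary_u, of r] by (simp add: unitary_def)
qed

lemma conj_u_B: "x \<in> B \<Longrightarrow> u * x * u\<^sup>\<dagger> = x"
  using conj_U_B[of x "Suc 0"] by (simp add: U_Suc)

lemma a_map_linear:
  "a_map S u i j (x + y) = a_map S u i j x + a_map S u i j y"
  "a_map S u i j (c *\<^sub>C x) = c *\<^sub>C a_map S u i j x"
  by (simp_all add: a_map_def distrib_left distrib_right scaleC_mult_left scaleC_mult_right)

lemma a_map_F:
  assumes "x \<in> F" "i \<in> {1..n}" "j \<in> {1..n}" shows "a_map S u i j x \<in> F"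
proof -
  have "x \<in> core n S k" using assms(1) core_mono[of "k - 1" k] by auto
  hence "u * x * u\<^sup>\<dagger> \<in> core n S (Suc (k - 1))"
    using k_ge_1 u_core by (simp add: core_mult core_adj)
  thus ?thesis using assms by (simp add: core_Suc a_map_def mult.assoc)
qed

lemma a_map_B:
  assumes x: "x \<in> B" and i: "i \<in> {1..n}" and j: "j \<in> {1..n}"
  shows "a_map S u i j x \<in> B"
proof -
  have F: "a_map S u i j x \<in> F" using assms B_subset a_map_F by blast
  have "a_map S u i j x = (S i)\<^sup>\<dagger> * (u * x * u\<^sup>\<dagger>) * S j" by (simp add: a_map_def mult.assoc)
  hence a: "a_map S u i j x = (S i)\<^sup>\<dagger> * x * S j" by (simp only: conj_u_B[OF x])
  have "(S i)\<^sup>\<dagger> * x * S j * (\<phi> ^^ m) u = (\<phi> ^^ m) u * ((S i)\<^sup>\<dagger> * x * S j)" for m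
  proof -
    have "(S i)\<^sup>\<dagger> * x * S j * (\<phi> ^^ m) u = (S i)\<^sup>\<dagger> * (x * (\<phi> ^^ Suc m) u) * S j"
      by (simp add: mult.assoc phi_S[OF j])
    also have "\<dots> = (S i)\<^sup>\<dagger> * \<phi> ((\<phi> ^^ m) u) * x * S j"
      unfolding B_commutes[OF x] by (simp add: mult.assoc)
    also have "\<dots> = (\<phi> ^^ m) u * ((S i)\<^sup>\<dagger> * x * S j)"
      by (simp only: adj_S_phi[OF i] mult.assoc)
    finally show ?thesis .
  qed
  thus ?thesis
    using F k_ge_1 by (auto simp: a B_alg_def commutant_def core_0)
qed

lemma subspace_X [simp]: "csubspace (X r)"
  by (cases r) simp_all

lemma X_Suc_subset: "X (Suc r) \<subseteq> X r"
proof (induction r)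
  case 0
  show ?case
    unfolding Xi.simps by (rule complex_vector.span_minimal) (auto intro: a_map_F)
next
  case (Suc r)
  show ?case
    by (subst (1 2) Xi.simps(2), rule complex_vector.span_mono) (use Suc in blast)
qed

lemma X_antimono: "r \<le> s \<Longrightarrow> X s \<subseteq> X r"
  by (rule lift_Suc_antimono_le) (rule X_Suc_subset)

lemma X_subset_F: "X r \<subseteq> F"
  using X_antimono[of 0 r] by simp

lemma one_in_X: "1 \<in> X r"
proof (induction r)
  case 0
  show ?case by (simp add: one_in_core)
next
  case (Suc r)
  have "a_map S u 1 1 1 = 1"
    using n_ge_2 unitary_u by (simp add: a_map_def mult.assoc unitary_cancel isometry)
  moreover have "a_map S u 1 1 1 \<in> X (Suc r)"
    unfolding Xi.simps(2) using Suc n_ge_2 by (intro complex_vector.span_base) force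
  ultimately show ?case by simp
qed

lemma span_one_subset_X: "cspan {1} \<subseteq> X r"
  by (rule complex_vector.span_minimal) (simp_all add: one_in_X)

text \<open>Any \<open>\<Xi>\<^sub>l\<close> of least dimension equals all later ones: a proper subspace of a finite-dimensional space
  has smaller dimension.\<close>

lemma X_stabilizes: "\<exists>l. \<forall>r\<ge>l. X r = X l"
proof -
  let ?G = "{S_word S \<alpha> * (S_word S \<beta>)\<^sup>\<dagger> | \<alpha> \<beta>. \<alpha> \<in> words n (k - 1) \<and> \<beta> \<in> words n (k - 1)}"
  have "finite (words n (k - 1))"
    unfolding words_def by (rule finite_lists_length_eq) simp
  hence "finite ((\<lambda>(\<alpha>, \<beta>). S_word S \<alpha> * (S_word S \<beta>)\<^sup>\<dagger>) ` (words n (k - 1) \<times> words n (k - 1)))"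
    by blast
  moreover have "?G = (\<lambda>(\<alpha>, \<beta>). S_word S \<alpha> * (S_word S \<beta>)\<^sup>\<dagger>) ` (words n (k - 1) \<times> words n (k - 1))"
    by auto
  ultimately have "finite ?G" by metis
  hence fin: "finite C" if "\<not> complex_vector.dependent C" "C \<subseteq> X r" for C r
  proof -
    have "C \<subseteq> cspan ?G" using that(2) X_subset_F unfolding core_def by (rule order_trans)
    thus ?thesis using complex_vector.independent_span_bound[OF \<open>finite ?G\<close> that(1)] by blast
  qed
  obtain l where least: "\<And>r. complex_vector.dim (X l) \<le> complex_vector.dim (X r)"
    using ex_has_least_nat[of "\<lambda>_. True" 0 "\<lambda>r. complex_vector.dim (X r)"] by blast
  have "X l \<subseteq> X r" if "l \<le> r" for r
  proof (rule ccontr)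
    assume "\<not> X l \<subseteq> X r"
    then obtain x where x: "x \<in> X l" "x \<notin> X r" by blast
    obtain C where C: "C \<subseteq> X r" "\<not> complex_vector.dependent C" "card C = complex_vector.dim (X r)"
      using complex_vector.basis_exists[of "X r"] by metis
    obtain D where D: "D \<subseteq> X l" "\<not> complex_vector.dependent D" "X l \<subseteq> cspan D"
      "card D = complex_vector.dim (X l)"
      using complex_vector.basis_exists[of "X l"] by metis
    have "x \<notin> cspan C"
      using x(2) complex_vector.span_minimal[OF C(1) subspace_X] by blast
    hence "\<not> complex_vector.dependent (insert x C)"
      using C(2) by (rule complex_vector.independent_insertI)
    moreover have "insert x C \<subseteq> cspan D"
      using x(1) C(1) D(3) X_antimono[OF that] by blast
    ultimately have "card (insert x C) \<le> card D"
      using complex_vector.independent_span_bound[OF fin[OF D(2,1)]] by blast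
    moreover have "card (insert x C) = Suc (card C)"
      using fin[OF C(2,1)] C(1) x(2) by (intro card_insert_disjoint) auto
    ultimately show False using least[of r] C(3) D(4) by simp
  qed
  hence "X r = X l" if "r \<ge> l" for r
    using that X_antimono[OF that] by blast
  thus ?thesis by blast
qed

lemma Xi_lim_subset_iff: "Xi_lim n S k u \<subseteq> Y \<longleftrightarrow> (\<exists>l. X l \<subseteq> Y)"
proof
  obtain l where l: "\<And>r. r \<ge> l \<Longrightarrow> X r = X l" using X_stabilizes by blast
  have "X l \<subseteq> X r" for r
    using l[of "max l r"] X_antimono[of r "max l r"] by simp
  hence "X l \<subseteq> Xi_lim n S k u" by (auto simp: Xi_lim_def)
  thus "Xi_lim n S k u \<subseteq> Y \<Longrightarrow> \<exists>l. X l \<subseteq> Y" by blast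
next
  show "\<exists>l. X l \<subseteq> Y \<Longrightarrow> Xi_lim n S k u \<subseteq> Y" by (auto simp: Xi_lim_def)
qed

lemma Xi_lim_eq_iff: "Xi_lim n S k u = cspan {1} \<longleftrightarrow> (\<exists>l. X l \<subseteq> cspan {1})"
proof -
  have "cspan {1} \<subseteq> Xi_lim n S k u" using span_one_subset_X by (auto simp: Xi_lim_def)
  thus ?thesis using Xi_lim_subset_iff[of "cspan {1}"] by blast
qed

lemma S_word_phi: "\<alpha> \<in> words n m \<Longrightarrow> (\<phi> ^^ m) a * S_word S \<alpha> = S_word S \<alpha> * a"
proof (induction m arbitrary: \<alpha>)
  case 0
  thus ?case by (simp add: words_def S_word_def)
next
  case (Suc m)
  then obtain i \<beta> where i: "i \<in> {1..n}" "\<beta> \<in> words n m" and \<alpha>: "\<alpha> = i # \<beta>"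
    by (auto simp: words_Suc)
  have "(\<phi> ^^ Suc m) a * S_word S \<alpha> = (\<phi> ((\<phi> ^^ m) a) * S i) * S_word S \<beta>"
    by (simp add: \<alpha> S_word_def mult.assoc)
  also have "\<dots> = S i * ((\<phi> ^^ m) a * S_word S \<beta>)"
    by (simp only: phi_S[OF i(1)] mult.assoc)
  also have "\<dots> = S_word S \<alpha> * a"
    by (simp only: Suc.IH[OF i(2)]) (simp add: \<alpha> S_word_def mult.assoc)
  finally show ?case .
qed

text \<open>The matrix entry at \<open>(\<alpha>, \<beta>)\<close> of the conjugate of \<open>x\<close> by \<open>U r\<close>.  It is used for words of a common
  length \<open>r\<close> only; taking \<open>r\<close> from the words avoids a further argument.\<close>

definition compression :: "nat list \<Rightarrow> nat list \<Rightarrow> 'a \<Rightarrow> 'a" where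
  "compression \<alpha> \<beta> x =
     (S_word S \<alpha>)\<^sup>\<dagger> * (U u (length \<alpha>) * x * (U u (length \<beta>))\<^sup>\<dagger>) * S_word S \<beta>"

text \<open>Moving \<open>u\<close> through \<open>S\<^sub>\<alpha>\<^sup>\<dagger>\<close> turns it into \<open>\<phi>\<^sup>m(u)\<close>, the next left factor of \<open>U\<close>, while the new generator
  joins the word at its right end.\<close>

lemma a_map_compression:
  assumes "\<alpha> \<in> words n m" "\<beta> \<in> words n m"
  shows "a_map S u i j (compression \<alpha> \<beta> x) = compression (\<alpha> @ [i]) (\<beta> @ [j]) x"
proof -
  let ?p = "(\<phi> ^^ m) u"
  have len: "length \<alpha> = m" "length \<beta> = m" using assms by (auto simp: words_def)
  have r: "S_word S \<beta> * u\<^sup>\<dagger> = ?p\<^sup>\<dagger> * S_word S \<beta>"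
    by (simp only: S_word_phi[OF assms(2)] flip: phi_iter_adj)
  have "(?p\<^sup>\<dagger> * S_word S \<alpha>)\<^sup>\<dagger> = (S_word S \<alpha> * u\<^sup>\<dagger>)\<^sup>\<dagger>"
    by (simp only: S_word_phi[OF assms(1)] flip: phi_iter_adj)
  hence l: "u * (S_word S \<alpha>)\<^sup>\<dagger> = (S_word S \<alpha>)\<^sup>\<dagger> * ?p"
    by (simp add: star_simps)
  have "a_map S u i j (compression \<alpha> \<beta> x) =
    (S i)\<^sup>\<dagger> * (u * (S_word S \<alpha>)\<^sup>\<dagger>) * (U u m * x * (U u m)\<^sup>\<dagger>) * (S_word S \<beta> * u\<^sup>\<dagger>) * S j"
    by (simp add: a_map_def compression_def len mult.assoc)
  also have "\<dots> = compression (\<alpha> @ [i]) (\<beta> @ [j]) x"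
    unfolding l r by (simp add: compression_def len U_Suc S_word_def star_simps mult.assoc)
  finally show ?thesis .
qed

lemma words_snoc: "words n (Suc m) = {\<alpha> @ [i] | i \<alpha>. i \<in> {1..n} \<and> \<alpha> \<in> words n m}"
  by (auto simp: words_def length_Suc_conv_rev)

text \<open>For \<open>r = 0\<close> this describes every \<open>\<Xi>\<^sub>m\<close> by matrix entries; the case of general \<open>r\<close> serves to continue
  from a stage where \<open>\<Xi>\<^sub>r\<close> is already contained in \<open>B\<close>.\<close>

lemma X_add:
  "X (r + m) = cspan {compression \<alpha> \<beta> x | \<alpha> \<beta> x. \<alpha> \<in> words n m \<and> \<beta> \<in> words n m \<and> x \<in> X r}"
proof (induction m)
  case 0
  have "{compression \<alpha> \<beta> x | \<alpha> \<beta> x. \<alpha> \<in> words n 0 \<and> \<beta> \<in> words n 0 \<and> x \<in> X r} = X r"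
    by (auto simp: words_def compression_def S_word_def)
  moreover have "cspan (X r) = X r" by (simp only: complex_vector.span_eq_iff subspace_X)
  ultimately show ?case by (simp only: add_0_right)
next
  case (Suc m)
  let ?G = "\<lambda>m. {compression \<alpha> \<beta> x | \<alpha> \<beta> x. \<alpha> \<in> words n m \<and> \<beta> \<in> words n m \<and> x \<in> X r}"
  let ?A = "\<lambda>Y. {a_map S u i j x | i j x. i \<in> {1..n} \<and> j \<in> {1..n} \<and> x \<in> Y}"
  have "X (r + Suc m) = cspan (?A (cspan (?G m)))" by (simp add: Suc)
  also have "\<dots> = cspan (?A (?G m))"
  proof
    have "a_map S u i j x \<in> cspan (?A (?G m))"
      if "i \<in> {1..n}" "j \<in> {1..n}" "x \<in> cspan (?G m)" for i j x
    proof (rule cspan_mapI[OF a_map_linear])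
      fix y assume "y \<in> ?G m"
      with that show "a_map S u i j y \<in> cspan (?A (?G m))"
        by (intro complex_vector.span_base) blast
    qed (use that in simp_all)
    thus "cspan (?A (cspan (?G m))) \<subseteq> cspan (?A (?G m))"
      by (intro complex_vector.span_minimal) auto
    have "?A (?G m) \<subseteq> ?A (cspan (?G m))" using complex_vector.span_superset[of "?G m"] by blast
    thus "cspan (?A (?G m)) \<subseteq> cspan (?A (cspan (?G m)))" by (rule complex_vector.span_mono)
  qed
  also have "?A (?G m) = ?G (Suc m)"
  proof (intro equalityI subsetI)
    fix y assume "y \<in> ?A (?G m)"
    then obtain i j \<alpha> \<beta> x where *: "i \<in> {1..n}" "j \<in> {1..n}" "\<alpha> \<in> words n m" "\<beta> \<in> words n m"
      "x \<in> X r" and y: "y = a_map S u i j (compression \<alpha> \<beta> x)" by blast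
    have "y = compression (\<alpha> @ [i]) (\<beta> @ [j]) x"
      unfolding y by (rule a_map_compression[OF *(3,4)])
    with * show "y \<in> ?G (Suc m)" unfolding words_snoc by blast
  next
    fix y assume "y \<in> ?G (Suc m)"
    then obtain i j \<alpha> \<beta> x where *: "i \<in> {1..n}" "j \<in> {1..n}" "\<alpha> \<in> words n m" "\<beta> \<in> words n m"
      "x \<in> X r" and y: "y = compression (\<alpha> @ [i]) (\<beta> @ [j]) x"
      unfolding words_snoc by blast
    have "y = a_map S u i j (compression \<alpha> \<beta> x)"
      unfolding y by (rule a_map_compression[OF *(3,4), symmetric])
    with * show "y \<in> ?A (?G m)" by blast
  qed
  finally show ?case .
qed

lemma compression_in_X:
  assumes "\<alpha> \<in> words n m" "\<beta> \<in> words n m" "x \<in> F"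
  shows "compression \<alpha> \<beta> x \<in> X m"
proof -
  have "compression \<alpha> \<beta> x \<in> X (0 + m)"
    unfolding X_add[of 0 m] using assms by (intro complex_vector.span_base) auto
  thus ?thesis by simp
qed

lemma compression_scalar:
  assumes "\<alpha> \<in> words n m" "\<beta> \<in> words n m" "U u m * x * (U u m)\<^sup>\<dagger> \<in> core n S m"
  shows "compression \<alpha> \<beta> x \<in> cspan {1}"
proof -
  have "length \<alpha> = m" "length \<beta> = m" using assms by (auto simp: words_def)
  thus ?thesis
    using assms core_add_iff[of "U u m * x * (U u m)\<^sup>\<dagger>" m 0] by (simp add: compression_def core_0)
qed

text \<open>Conjugation by \<open>U\<close> fixes the elements of \<open>B\<close>, and their entries at words of length \<open>k - 1\<close> are
  scalar because \<open>B \<subseteq> F\<close>.\<close>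

lemma X_subset_B_iff: "(\<exists>l. X l \<subseteq> B) \<longleftrightarrow> (\<exists>l. X l \<subseteq> cspan {1})"
proof
  assume "\<exists>l. X l \<subseteq> B"
  then obtain l where l: "X l \<subseteq> B" ..
  have "compression \<alpha> \<beta> x \<in> cspan {1}"
    if "\<alpha> \<in> words n (k - 1)" "\<beta> \<in> words n (k - 1)" "x \<in> X l" for \<alpha> \<beta> x
  proof (rule compression_scalar[OF that(1,2)])
    have "x \<in> B" "x \<in> F" using that(3) l B_subset by auto
    thus "U u (k - 1) * x * (U u (k - 1))\<^sup>\<dagger> \<in> F" by (simp only: conj_U_B)
  qed
  hence "X (l + (k - 1)) \<subseteq> cspan {1}"
    unfolding X_add[of l "k - 1"] by (intro complex_vector.span_minimal) auto
  thus "\<exists>l. X l \<subseteq> cspan {1}" ..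
qed (use span_one_subset_B in blast)

section \<open>Scalar spaces and invertibility\<close>

text \<open>The inverse \<open>\<lambda>\<^sub>v\<close> raises the level by at most \<open>h\<close>, so \<open>y = \<lambda>\<^sub>v(x)\<close> has level \<open>h + k - 1\<close> for all \<open>x\<close> in
  \<open>F\<close>; solving \<open>x = \<lambda>\<^sub>u(y)\<close> at that level gives \<open>U x U\<^sup>\<dagger> = y\<close>.\<close>

lemma scalar_X_if_inverse:
  assumes v: "unitary v" "v \<in> core n S h" "lam n S u v = u\<^sup>\<dagger>"
  shows "\<exists>l. X l \<subseteq> cspan {1}"
proof -
  let ?l = "h + (k - 1)"
  have right: "lam n S u \<circ> lam n S v = id"
    using lam_inverse_iff unitary_u v by blast
  have "compression \<alpha> \<beta> x \<in> cspan {1}"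
    if "\<alpha> \<in> words n ?l" "\<beta> \<in> words n ?l" "x \<in> F" for \<alpha> \<beta> x
  proof -
    let ?y = "lam n S v x"
    have y: "?y \<in> core n S ?l" by (rule lam_maps_core[OF v(1,2) that(3)])
    have "x = lam n S u ?y" using fun_cong[OF right, of x] by simp
    hence x: "x = (U u ?l)\<^sup>\<dagger> * ?y * U u ?l" by (simp only: lam_core[OF unitary_u y])
    have "U u ?l * x * (U u ?l)\<^sup>\<dagger> = (U u ?l * (U u ?l)\<^sup>\<dagger>) * ?y * (U u ?l * (U u ?l)\<^sup>\<dagger>)"
      by (subst x) (simp only: mult.assoc)
    hence "U u ?l * x * (U u ?l)\<^sup>\<dagger> = ?y"
      using unitary_U[OF unitary_u, of ?l] by (simp add: unitary_def)
    thus ?thesis using that y by (intro compression_scalar[of _ ?l]) simp_all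
  qed
  hence "X (0 + ?l) \<subseteq> cspan {1}"
    unfolding X_add[of 0 ?l] by (intro complex_vector.span_minimal) auto
  thus ?thesis by blast
qed

text \<open>Scalar entries at level \<open>l\<close> make \<open>U m x (U m)\<^sup>\<dagger>\<close> independent of \<open>m \<ge> l\<close> for \<open>x\<close> in \<open>F\<close>.  This is
  applied to the entries of \<open>u\<^sup>\<dagger>\<close>: as \<open>U (m + 1) = \<phi>(U m) u\<close>, conjugating \<open>u\<^sup>\<dagger>\<close> by \<open>U (m + 1)\<close>
  conjugates each of its entries by \<open>U m\<close>.\<close>

lemma stabilizes_if_scalar_X:
  assumes l: "X l \<subseteq> cspan {1}"
  shows "\<exists>c. \<forall>\<^sub>F m in sequentially. Ad (u_prod n S u m) (u\<^sup>\<dagger>) = c"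
proof -
  have stable: "U u m * x * (U u m)\<^sup>\<dagger> = U u l * x * (U u l)\<^sup>\<dagger>" if x: "x \<in> F" and "l \<le> m" for x m
  proof (rule conj_U_stable[OF _ unitary_u that(2)])
    have "(S_word S \<alpha>)\<^sup>\<dagger> * (U u l * x * (U u l)\<^sup>\<dagger>) * S_word S \<beta> \<in> core n S 0"
      if "\<alpha> \<in> words n l" "\<beta> \<in> words n l" for \<alpha> \<beta>
    proof -
      have "length \<alpha> = l" "length \<beta> = l" using that by (auto simp: words_def)
      thus ?thesis
        using compression_in_X[OF that x] l by (auto simp: compression_def core_0)
    qed
    thus "U u l * x * (U u l)\<^sup>\<dagger> \<in> core n S l" using core_add_iff[of _ l 0] by simp
  qed
  have "u\<^sup>\<dagger> \<in> core n S (Suc (k - 1))" using k_ge_1 u_core by (simp add: core_adj)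
  hence entry: "(S i)\<^sup>\<dagger> * u\<^sup>\<dagger> * S j \<in> F" if "i \<in> {1..n}" "j \<in> {1..n}" for i j
    using that by (simp add: core_Suc)
  have "Ad (U u (Suc m)) (u\<^sup>\<dagger>) = (\<Sum>i=1..n. \<Sum>j=1..n.
      S i * (U u l * ((S i)\<^sup>\<dagger> * u\<^sup>\<dagger> * S j) * (U u l)\<^sup>\<dagger>) * (S j)\<^sup>\<dagger>)" (is "_ = ?c") if "l \<le> m" for m
  proof -
    have "Ad (U u (Suc m)) (u\<^sup>\<dagger>) = \<phi> (U u m) * (u * u\<^sup>\<dagger>) * u\<^sup>\<dagger> * (\<phi> (U u m))\<^sup>\<dagger>"
      by (simp add: Ad_def U_Suc_phi star_simps mult.assoc)
    also have "\<dots> = \<phi> (U u m) * u\<^sup>\<dagger> * \<phi> ((U u m)\<^sup>\<dagger>)"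
      using unitary_u by (simp add: unitary_def phi_adj)
    also have "\<dots> = (\<Sum>i=1..n. \<Sum>j=1..n.
        \<phi> (U u m) * (S i * ((S i)\<^sup>\<dagger> * u\<^sup>\<dagger> * S j) * (S j)\<^sup>\<dagger>) * \<phi> ((U u m)\<^sup>\<dagger>))"
      by (subst matrix_expansion[of "u\<^sup>\<dagger>"]) (simp only: sum_distrib_left sum_distrib_right)
    also have "\<dots> = ?c"
    proof (intro sum.cong refl)
      fix i j assume ij: "i \<in> {1..n}" "j \<in> {1..n}"
      let ?x = "(S i)\<^sup>\<dagger> * u\<^sup>\<dagger> * S j"
      have "\<phi> (U u m) * (S i * ?x * (S j)\<^sup>\<dagger>) * \<phi> ((U u m)\<^sup>\<dagger>)
          = (\<phi> (U u m) * S i) * ?x * ((S j)\<^sup>\<dagger> * \<phi> ((U u m)\<^sup>\<dagger>))"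
        by (simp only: mult.assoc)
      also have "\<dots> = S i * (U u m * ?x * (U u m)\<^sup>\<dagger>) * (S j)\<^sup>\<dagger>"
        by (simp only: phi_S[OF ij(1)] adj_S_phi[OF ij(2)] mult.assoc)
      finally show "\<phi> (U u m) * (S i * ?x * (S j)\<^sup>\<dagger>) * \<phi> ((U u m)\<^sup>\<dagger>)
          = S i * (U u l * ?x * (U u l)\<^sup>\<dagger>) * (S j)\<^sup>\<dagger>"
        by (simp only: stable[OF entry[OF ij] that])
    qed
    finally show ?thesis .
  qed
  thus ?thesis unfolding eventually_sequentially u_prod_eq by blast
qed

section \<open>Nilpotency\<close>

abbreviation "V \<equiv> V_quot n S k u"

definition ring_prod :: "('a set \<Rightarrow> 'a set) list \<Rightarrow> 'a set \<Rightarrow> 'a set" where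
  "ring_prod fs = foldr (compose V) fs (\<lambda>C\<in>V. C)"

lemma ring_prod_apply:
  "C \<in> V \<Longrightarrow> ring_prod [] C = C"
  "C \<in> V \<Longrightarrow> ring_prod (f # fs) C = f (ring_prod fs C)"
  "C \<notin> V \<Longrightarrow> ring_prod fs C = undefined"
  by (simp_all add: ring_prod_def compose_def) (cases fs; simp add: compose_def)

lemma coset_in_V: "x \<in> F \<Longrightarrow> x +o B \<in> V"
  by (simp add: V_quot_def)

lemma coset_zero_iff: "x +o B = B \<longleftrightarrow> x \<in> B"
proof
  assume "x +o B = B"
  moreover have "x \<in> x +o B"
    using complex_vector.subspace_0[OF subspace_B] by (force simp: elt_set_plus_def)
  ultimately show "x \<in> B" by simp
next
  assume x: "x \<in> B"
  show "x +o B = B"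
  proof (intro equalityI subsetI)
    fix y assume "y \<in> B"
    hence "y - x \<in> B" using x by (intro complex_vector.subspace_diff) simp_all
    thus "y \<in> x +o B" by (force simp: elt_set_plus_def)
  qed (use x in \<open>auto simp: elt_set_plus_def complex_vector.subspace_add\<close>)
qed

lemma B_plus_B: "B + B = B"
proof (intro equalityI subsetI)
  fix y assume "y \<in> B"
  hence "y + 0 \<in> B + B" by (intro set_plus_intro) (simp_all add: complex_vector.subspace_0)
  thus "y \<in> B + B" by simp
qed (auto simp: set_plus_def complex_vector.subspace_add)

lemma coset_add: "(x +o B) + (y +o B) = (x + y) +o B"
  by (simp add: set_plus_rearrange B_plus_B)

lemma coset_minus: "uminus ` (x +o B) = (- x) +o B"
proof (intro equalityI subsetI)
  fix c assume "c \<in> uminus ` (x +o B)"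
  then obtain b where "b \<in> B" "c = - x + - b" by (auto simp: elt_set_plus_def)
  thus "c \<in> (- x) +o B"
    using complex_vector.subspace_neg[OF subspace_B] by (auto simp: elt_set_plus_def)
next
  fix c assume "c \<in> (- x) +o B"
  then obtain b where "b \<in> B" and c: "c = - (x + - b)" by (auto simp: elt_set_plus_def)
  hence "x + - b \<in> x +o B"
    by (intro set_plus_intro2 complex_vector.subspace_neg[OF subspace_B])
  thus "c \<in> uminus ` (x +o B)" unfolding c by (rule imageI)
qed

lemma a_quot_coset:
  assumes "x \<in> F" "i \<in> {1..n}" "j \<in> {1..n}"
  shows "a_quot n S k u i j (x +o B) = a_map S u i j x +o B"
proof -
  let ?a = "a_map S u i j"
  have "?a ` (x +o B) + B = ?a x +o (?a ` B + B)"
    by (force simp: elt_set_plus_def set_plus_def a_map_linear add.assoc)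
  also have "?a ` B + B = B"
  proof (intro equalityI subsetI)
    fix y assume "y \<in> B"
    moreover have "?a 0 = 0" by (simp add: a_map_def)
    ultimately have "?a 0 + y \<in> ?a ` B + B"
      by (intro set_plus_intro) (simp_all add: complex_vector.subspace_0)
    thus "y \<in> ?a ` B + B" using \<open>?a 0 = 0\<close> by simp
  qed (use assms a_map_B in \<open>auto simp: set_plus_def intro: complex_vector.subspace_add\<close>)
  finally show ?thesis using coset_in_V[OF assms(1)] by (simp add: a_quot_def)
qed

text \<open>The ring lowers the filtration of the quotient space by the images of the \<open>\<Xi>\<^sub>r\<close>.  Stating this as
  the existence of a representative \<open>y\<close> makes it pass through sums and products without first
  proving that ring elements are linear.\<close>

lemma A_ring_filtration:
  "f \<in> A_ring n S k u \<Longrightarrow> x \<in> X r \<Longrightarrow> \<exists>y\<in>X (Suc r). f (x +o B) = y +o B"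
proof (induction f arbitrary: x r rule: A_ring.induct)
  case (gen i j)
  have "a_map S u i j x \<in> X (Suc r)"
    unfolding Xi.simps using gen by (intro complex_vector.span_base) blast
  moreover have "x \<in> F" using gen X_subset_F by blast
  ultimately show ?case using a_quot_coset gen by blast
next
  case zero
  have "zero_map n S k u (x +o B) = 0 +o B"
    using coset_in_V[of x] zero X_subset_F by (auto simp: zero_map_def)
  moreover have "0 \<in> X (Suc r)" by (rule complex_vector.subspace_0[OF subspace_X])
  ultimately show ?case by blast
next
  case (add f g)
  then obtain y z where "y \<in> X (Suc r)" "z \<in> X (Suc r)"
    "f (x +o B) = y +o B" "g (x +o B) = z +o B" by meson
  moreover have "x +o B \<in> V" using add.prems X_subset_F coset_in_V by blast
  ultimately show ?case
    by (intro bexI[of _ "y + z"]) (simp_all add: coset_add complex_vector.subspace_add del: Xi.simps)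
next
  case (minus f)
  then obtain y where "y \<in> X (Suc r)" "f (x +o B) = y +o B" by meson
  moreover have "x +o B \<in> V" using minus.prems X_subset_F coset_in_V by blast
  ultimately show ?case
    by (intro bexI[of _ "- y"]) (simp_all add: coset_minus complex_vector.subspace_neg del: Xi.simps)
next
  case (mult f g)
  then obtain y where y: "y \<in> X (Suc r)" "g (x +o B) = y +o B" by meson
  then obtain z where z: "z \<in> X (Suc (Suc r))" "f (y +o B) = z +o B" using mult.IH(1) by meson
  have "x +o B \<in> V" using mult.prems X_subset_F coset_in_V by blast
  with y z show ?case
    using X_Suc_subset[of "Suc r"] by (intro bexI[of _ z]) (auto simp: compose_def simp del: Xi.simps)
qed

lemma ring_prod_filtration:
  "set fs \<subseteq> A_ring n S k u \<Longrightarrow> x \<in> F \<Longrightarrow> \<exists>y\<in>X (length fs). ring_prod fs (x +o B) = y +o B"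
proof (induction fs)
  case Nil
  thus ?case by (auto simp: coset_in_V ring_prod_apply)
next
  case (Cons f fs)
  then obtain y where y: "y \<in> X (length fs)" "ring_prod fs (x +o B) = y +o B" by auto
  then obtain z where "z \<in> X (Suc (length fs))" "f (y +o B) = z +o B"
    using A_ring_filtration[of f y "length fs"] Cons.prems by auto
  thus ?case
    using y coset_in_V[OF Cons.prems(2)] by (auto simp: ring_prod_apply simp del: Xi.simps)
qed

lemma compression_as_product:
  "\<alpha> \<in> words n m \<Longrightarrow> \<beta> \<in> words n m \<Longrightarrow> \<exists>fs. set fs \<subseteq> A_ring n S k u \<and> length fs = m \<and>
    (\<forall>x\<in>F. ring_prod fs (x +o B) = compression \<alpha> \<beta> x +o B)"
proof (induction m arbitrary: \<alpha> \<beta>)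
  case 0
  thus ?case
    by (intro exI[of _ "[]"])
      (simp add: words_def compression_def S_word_def coset_in_V ring_prod_apply)
next
  case (Suc m)
  then obtain \<alpha>' i \<beta>' j where ab: "\<alpha> = \<alpha>' @ [i]" "\<beta> = \<beta>' @ [j]" "i \<in> {1..n}" "j \<in> {1..n}"
    "\<alpha>' \<in> words n m" "\<beta>' \<in> words n m"
    unfolding words_snoc by blast
  then obtain fs where fs: "set fs \<subseteq> A_ring n S k u" "length fs = m"
    and prod: "\<forall>x\<in>F. ring_prod fs (x +o B) = compression \<alpha>' \<beta>' x +o B"
    using Suc.IH[OF ab(5,6)] by blast
  have "ring_prod (a_quot n S k u i j # fs) (x +o B) = compression \<alpha> \<beta> x +o B" if x: "x \<in> F" for x
  proof -
    have y: "compression \<alpha>' \<beta>' x \<in> F" using ab x compression_in_X X_subset_F by blast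
    have "ring_prod (a_quot n S k u i j # fs) (x +o B) =
        a_quot n S k u i j (compression \<alpha>' \<beta>' x +o B)"
      using prod x coset_in_V[OF x] by (simp add: ring_prod_apply)
    also have "\<dots> = compression \<alpha> \<beta> x +o B"
      using a_quot_coset[OF y ab(3,4)] a_map_compression[OF ab(5,6)] ab(1,2) by simp
    finally show ?thesis .
  qed
  moreover have "a_quot n S k u i j \<in> A_ring n S k u" using ab by (intro A_ring.gen)
  ultimately show ?case using fs by (intro exI[of _ "a_quot n S k u i j # fs"]) auto
qed

text \<open>Products of generators realize all the entries that span \<open>\<Xi>\<^sub>l\<close>, which gives one direction; the other
  is the filtration.  There \<open>l + 1\<close> factors are taken because the empty product does not count.\<close>

lemma A_nilpotent_iff: "A_nilpotent n S k u \<longleftrightarrow> (\<exists>l. X l \<subseteq> B)"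
proof
  assume "A_nilpotent n S k u"
  then obtain l where nil: "\<And>fs. set fs \<subseteq> A_ring n S k u \<Longrightarrow> length fs = l \<Longrightarrow>
      ring_prod fs = zero_map n S k u"
    unfolding A_nilpotent_def ring_prod_def by blast
  have "compression \<alpha> \<beta> x \<in> B"
    if words: "\<alpha> \<in> words n l" "\<beta> \<in> words n l" and x: "x \<in> F" for \<alpha> \<beta> x
  proof -
    obtain fs where "set fs \<subseteq> A_ring n S k u" "length fs = l"
      and prod: "ring_prod fs (x +o B) = compression \<alpha> \<beta> x +o B"
      using compression_as_product[OF words] x by blast
    hence "compression \<alpha> \<beta> x +o B = zero_map n S k u (x +o B)"
      using nil[of fs] prod by simp
    thus ?thesis using coset_in_V[OF x] by (simp add: zero_map_def coset_zero_iff)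
  qed
  hence "X (0 + l) \<subseteq> B"
    unfolding X_add[of 0 l] by (intro complex_vector.span_minimal) auto
  thus "\<exists>l. X l \<subseteq> B" by auto
next
  assume "\<exists>l. X l \<subseteq> B"
  then obtain l where "X l \<subseteq> B" ..
  hence l: "X (Suc l) \<subseteq> B" using X_Suc_subset by blast
  have "ring_prod fs = zero_map n S k u" if fs: "set fs \<subseteq> A_ring n S k u" "length fs = Suc l" for fs
  proof
    fix C
    show "ring_prod fs C = zero_map n S k u C"
    proof (cases "C \<in> V")
      case True
      then obtain x where x: "x \<in> F" "C = x +o B" by (auto simp: V_quot_def)
      obtain y where "y \<in> X (Suc l)" "ring_prod fs C = y +o B"
        using ring_prod_filtration[OF fs(1) x(1)] unfolding fs(2) x(2) by blast
      with l have "ring_prod fs C = B" using coset_zero_iff by blast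
      with True show ?thesis by (simp add: zero_map_def)
    next
      case False
      thus ?thesis by (simp add: zero_map_def ring_prod_apply)
    qed
  qed
  thus "A_nilpotent n S k u"
    unfolding A_nilpotent_def ring_prod_def by (intro exI[of _ "Suc l"]) auto
qed

end

theorem theorem3p2:
  fixes n k :: nat and S :: "nat \<Rightarrow> 'a::cstar_algebra" and u :: 'a
  assumes "cuntz_algebra n S"
    and "k \<ge> 1"
    and "unitary u" and "u \<in> core n S k"
  shows
    "((bij (lam n S u) \<and> localized n S (inv (lam n S u)))
       \<longleftrightarrow> (\<exists>c. \<forall>\<^sub>F m in sequentially. Ad (u_prod n S u m) (u\<^sup>\<dagger>) = c)) \<and>
     ((\<exists>c. \<forall>\<^sub>F m in sequentially. Ad (u_prod n S u m) (u\<^sup>\<dagger>) = c)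
       \<longleftrightarrow> A_nilpotent n S k u) \<and>
     (A_nilpotent n S k u \<longleftrightarrow> Xi_lim n S k u \<subseteq> B_alg n S k u) \<and>
     (Xi_lim n S k u \<subseteq> B_alg n S k u \<longleftrightarrow> Xi_lim n S k u = cspan {1})"
proof -
  interpret core_unitary n S k u
    using assms by (simp add: core_unitary_def core_unitary_axioms_def)
  let ?inverse = "\<exists>h v. unitary v \<and> v \<in> core n S h \<and> lam n S u v = u\<^sup>\<dagger>"
  let ?stable = "\<exists>c. \<forall>\<^sub>F m in sequentially. Ad (u_prod n S u m) (u\<^sup>\<dagger>) = c"
  have "bij (lam n S u) \<and> localized n S (inv (lam n S u)) \<longleftrightarrow> ?inverse"
    by (rule localized_inverse_iff[OF assms(3,4)])
  moreover have stable: "?stable \<longleftrightarrow> ?inverse"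
    by (rule stabilizes_iff[OF assms(3,4)])
  moreover have "?stable \<longleftrightarrow> (\<exists>l. Xi n S k u l \<subseteq> cspan {1})"
    using stable scalar_X_if_inverse stabilizes_if_scalar_X by blast
  ultimately show ?thesis
    using A_nilpotent_iff X_subset_B_iff Xi_lim_subset_iff[of "B_alg n S k u"] Xi_lim_eq_iff
    by blast
qed

end
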